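(* Let $\mathcal{SIO}$ be the class of all finite permutations contained in the infinite increasing oscillation $2,4,1,6,3,8,5,10,7,\dots$. Then $\mathcal{SIO}$ has an exponential Wilf-collapse: if $c_n$ denotes the number of permutations of size $n$ in $\mathcal{SIO}$ and $w_n$ denotes the number of equivalence classes of Wilf-equivalence in $\mathcal{SIO}$ among those permutations of size $n$, then there is a constant $r$ with $0<r<1$ such that $w_n = o(r^n c_n)$ as $n \to \infty$.
   Context: A permutation $\pi$ of size $k$ is contained in a permutation (or infinite sequence of distinct numbers) $\tau$, written $\pi \leq \tau$, if $\tau$ has a subsequence of $k$ entries in the same relative order as $\pi$; otherwise $\tau$ avoids $\pi$. The infinite increasing oscillation is the sequence $(s_i)_{i\ge1}$ with $s_1=2$, $s_{2j}=2j+2$ for $j\ge1$ and $s_{2j+1}=2j-1$ for $j\geq 1$. Wilf-equivalence in $\mathcal{SIO}$: for $\alpha,\beta\in\mathcal{SIO}$, $\alpha$ and $\beta$ are Wilf-equivalent in $\mathcal{SIO}$ if for every $m$ the number of permutations of size $m$ in $\mathcal{SIO}$ avoiding $\alpha$ equals the number of permutations of size $m$ in $\mathcal{SIO}$ avoiding $\beta$. *)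

theory Defs
  imports "HOL-Library.Landau_Symbols" "HOL-Combinatorics.Multiset_Permutations"
begin

text \<open>
  A permutation of size \<open>n\<close> is represented in one-line notation, as a list in
  \<open>permutations_of_set {1..n}\<close>.
\<close>

definition perms :: "nat list set" where
  "perms = (\<Union>n. permutations_of_set {1..n})"

text \<open>
  The sequence with index set \<open>I\<close> and entries \<open>t i\<close> may be finite or infinite; \<open>f\<close> gives
  the positions of a subsequence in the same relative order as \<open>p\<close>.
\<close>

definition occurs_in :: "nat list \<Rightarrow> nat set \<Rightarrow> (nat \<Rightarrow> nat) \<Rightarrow> bool" where
  "occurs_in p I t \<longleftrightarrow>
     (\<exists>f. strict_mono_on {..<length p} f \<and> f ` {..<length p} \<subseteq> I \<and>
          (\<forall>i<length p. \<forall>j<length p. p ! i < p ! j \<longleftrightarrow> t (f i) < t (f j)))"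

definition perm_contained :: "nat list \<Rightarrow> nat list \<Rightarrow> bool" where
  "perm_contained p q \<longleftrightarrow> occurs_in p {..<length q} (\<lambda>i. q ! i)"

text \<open>The oscillation is indexed from 1; its value at 0 is irrelevant.\<close>

definition osc :: "nat \<Rightarrow> nat" where
  "osc i = (if i = 1 then 2 else if even i then i + 2 else i - 2)"

lemma osc_1: "osc 1 = 2"
  by (simp add: osc_def)

lemma osc_even: "j \<ge> 1 \<Longrightarrow> osc (2 * j) = 2 * j + 2"
  by (simp add: osc_def)

lemma osc_odd: "j \<ge> 1 \<Longrightarrow> osc (2 * j + 1) = 2 * j - 1"
  by (simp add: osc_def)

definition SIO :: "nat list set" where
  "SIO = {p \<in> perms. occurs_in p {1..} osc}"

definition of_size :: "nat list set \<Rightarrow> nat \<Rightarrow> nat list set" where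
  "of_size C n = {p \<in> C. length p = n}"

definition wilf_equivalence :: "nat list set \<Rightarrow> (nat list \<times> nat list) set" where
  "wilf_equivalence C = {(a, b). a \<in> C \<and> b \<in> C \<and>
     (\<forall>m. card {p \<in> of_size C m. \<not> perm_contained a p} =
          card {p \<in> of_size C m. \<not> perm_contained b p})}"

lemma equiv_wilf_equivalence: "equiv C (wilf_equivalence C)"
  by (rule equivI) (auto simp: wilf_equivalence_def refl_on_def sym_def trans_def)

definition num_wilf_classes :: "nat list set \<Rightarrow> nat \<Rightarrow> nat" where
  "num_wilf_classes C n = card (of_size C n // Restr (wilf_equivalence C) (of_size C n))"

definition exponential_wilf_collapse :: "nat list set \<Rightarrow> bool" where
  "exponential_wilf_collapse C \<longleftrightarrow>
     (\<exists>r::real. 0 < r \<and> r < 1 \<and>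
        (\<lambda>n. real (num_wilf_classes C n)) \<in> o(\<lambda>n. r ^ n * real (card (of_size C n))))"

end

theory Submission
  imports Defs
begin

text \<open>
  A permutation in SIO is a sum of sum-indecomposable components, each a piece of the oscillation,
  and all such sums occur. Containment is greedy: a component is mapped into a single component, and
  two consecutive components mapped into the same one must leave out a vertex in between.

  For all \<open>A\<close> and \<open>B\<close>, the permutations \<open>A \<oplus> 312 \<oplus> 1 \<oplus> 21 \<oplus> 312 \<oplus> B\<close> and
  \<open>A \<oplus> 312 \<oplus> 21 \<oplus> 1 \<oplus> 312 \<oplus> B\<close> are Wilf-equivalent. In a permutation fix the leftmost occurrence of
  \<open>A \<oplus> 312\<close> and the rightmost occurrence of \<open>312 \<oplus> B\<close>, and reverse the part in between along the
  path: this exchanges the occurrences of \<open>1 \<oplus> 21\<close> and of \<open>21 \<oplus> 1\<close> in that part, while the orientation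
  of the components at its two ends is determined by the fixed occurrences.

  Hence every Wilf class has a representative without four consecutive components 312, 1, 21, 312.
  Excluding a block of components lowers the exponential growth rate.
\<close>


section \<open>Permutations in SIO as sets of path vertices\<close>

text \<open>The reflection does not act on permutations themselves. Components of size 1 and 2 have
  no orientation, reversal can change the parity at which a component starts, and it moves the
  places where two vertices instead of one are missing between components. So the count runs over
  all vertex sets with gaps of one or two. A permutation with \<open>s\<close> small components is
  represented by \<open>2 ^ s\<close> such sets, which is corrected by a weight of 1/2 per small
  component. The reflection must then preserve the number of small components, although it may
  lengthen or shorten the components that straddle its ends. The two copies of 312 ensure this: they
  put three consecutive vertices on each side of the reflected interval. The swapped components are
  1 and 21 because only sizes 1 and 2 embed regardless of parity, so their occurrences survive a
  change of parity. The growth rates are compared without asymptotics: two explicit numbers just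
  above the root of \<open>F z = 1\<close> give a lower bound for all words and an upper bound for
  the reduced ones.\<close>

text \<open>
  The inversion graph of the oscillation is an infinite path, whose vertices we number
  \<open>1, 2, 3, \<dots>\<close> along the path; the entries in this order are \<open>2, 1, 4, 3, 6, 5, \<dots>\<close>.
  The relations \<open>lt1\<close> and \<open>lt2\<close> compare two vertices by position and by value in the oscillation.
\<close>

definition lt1 :: "nat \<Rightarrow> nat \<Rightarrow> bool" where
  "lt1 x y \<longleftrightarrow> x + 2 \<le> y \<or> odd x \<and> (y = x + 1 \<or> x = y + 1)"

definition lt2 :: "nat \<Rightarrow> nat \<Rightarrow> bool" where
  "lt2 x y \<longleftrightarrow> x + 2 \<le> y \<or> odd y \<and> (y = x + 1 \<or> x = y + 1)"

lemma lt1_asym: "lt1 x y \<Longrightarrow> \<not> lt1 y x"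
  by (auto simp: lt1_def)

lemma lt1_total: "x \<noteq> y \<Longrightarrow> lt1 x y \<or> lt1 y x"
  unfolding lt1_def by presburger

lemma lt2_asym: "lt2 x y \<Longrightarrow> \<not> lt2 y x"
  by (auto simp: lt2_def)

lemma lt2_total: "x \<noteq> y \<Longrightarrow> lt2 x y \<or> lt2 y x"
  unfolding lt2_def by presburger

lemma lt1_lt2: "lt1 x y \<and> lt2 x y \<longleftrightarrow> x + 2 \<le> y"
  by (auto simp: lt1_def lt2_def)

text \<open>An involution taking a path vertex \<open>x \<ge> 1\<close> to its position in the oscillation, and back.\<close>

definition path_index :: "nat \<Rightarrow> nat" where
  "path_index x = (if x \<le> 1 then x else if odd x then x - 1 else x + 1)"

lemma path_index_involution: "path_index (path_index x) = x"
  unfolding path_index_def by (cases "x \<le> 1"; cases "odd x"; simp; presburger)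

lemma path_index_pos: "1 \<le> x \<Longrightarrow> 1 \<le> path_index x"
  by (auto simp: path_index_def)

lemma inj_path_index: "inj path_index"
  by (metis injI path_index_involution)

lemma path_index_less: "1 \<le> x \<Longrightarrow> 1 \<le> y \<Longrightarrow> path_index x < path_index y \<longleftrightarrow> lt1 x y"
  unfolding path_index_def lt1_def by (cases "x = 1"; cases "y = 1"; auto; presburger)

lemma osc_path_index_less:
  "1 \<le> x \<Longrightarrow> 1 \<le> y \<Longrightarrow> osc (path_index x) < osc (path_index y) \<longleftrightarrow> lt2 x y"
  unfolding path_index_def lt2_def osc_def by (cases "x = 1"; cases "y = 1"; auto; presburger)

text \<open>Implications suffice: both relations are total and asymmetric on distinct vertices, so
  \<open>g\<close> is injective on \<open>V\<close> and reflects them as well.\<close>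

definition embeds :: "nat set \<Rightarrow> nat set \<Rightarrow> bool" where
  "embeds V W \<longleftrightarrow> (\<exists>g. g ` V \<subseteq> W \<and>
     (\<forall>x\<in>V. \<forall>y\<in>V. (lt1 x y \<longrightarrow> lt1 (g x) (g y)) \<and> (lt2 x y \<longrightarrow> lt2 (g x) (g y))))"

lemma embeds_mono: "V \<subseteq> W \<Longrightarrow> embeds V W"
  unfolding embeds_def by (rule exI[of _ id]) auto

lemma embeds_trans:
  assumes "embeds U V" "embeds V W"
  shows "embeds U W"
proof -
  obtain g where g: "g ` U \<subseteq> V"
    "\<forall>x\<in>U. \<forall>y\<in>U. (lt1 x y \<longrightarrow> lt1 (g x) (g y)) \<and> (lt2 x y \<longrightarrow> lt2 (g x) (g y))"
    using assms(1) unfolding embeds_def by blast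
  obtain h where h: "h ` V \<subseteq> W"
    "\<forall>x\<in>V. \<forall>y\<in>V. (lt1 x y \<longrightarrow> lt1 (h x) (h y)) \<and> (lt2 x y \<longrightarrow> lt2 (h x) (h y))"
    using assms(2) unfolding embeds_def by blast
  show ?thesis unfolding embeds_def
    by (rule exI[of _ "h \<circ> g"]) (use g h in \<open>auto simp: image_subset_iff\<close>)
qed

lemma embeds_Un:
  assumes "embeds A A'" "embeds B B'"
    and "\<And>a b. a \<in> A \<Longrightarrow> b \<in> B \<Longrightarrow> a + 2 \<le> b"
    and "\<And>a b. a \<in> A' \<Longrightarrow> b \<in> B' \<Longrightarrow> a + 2 \<le> b"
  shows "embeds (A \<union> B) (A' \<union> B')"
proof -
  obtain g where g: "g ` A \<subseteq> A'"
    "\<forall>x\<in>A. \<forall>y\<in>A. (lt1 x y \<longrightarrow> lt1 (g x) (g y)) \<and> (lt2 x y \<longrightarrow> lt2 (g x) (g y))"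
    using assms(1) unfolding embeds_def by blast
  obtain h where h: "h ` B \<subseteq> B'"
    "\<forall>x\<in>B. \<forall>y\<in>B. (lt1 x y \<longrightarrow> lt1 (h x) (h y)) \<and> (lt2 x y \<longrightarrow> lt2 (h x) (h y))"
    using assms(2) unfolding embeds_def by blast
  have disj: "x \<notin> B" if "x \<in> A" for x using assms(3)[OF that, of x] by auto
  have AB: "lt1 x y" "lt2 x y" "\<not> lt1 y x" "\<not> lt2 y x" if "x \<in> A" "y \<in> B" for x y
    using assms(3)[OF that] lt1_lt2 lt1_asym lt2_asym by blast+
  have gh: "lt1 (g x) (h y)" "lt2 (g x) (h y)" if "x \<in> A" "y \<in> B" for x y
    using assms(4)[of "g x" "h y"] that g(1) h(1) lt1_lt2 by blast+
  let ?f = "\<lambda>x. if x \<in> A then g x else h x"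
  have "(lt1 x y \<longrightarrow> lt1 (?f x) (?f y)) \<and> (lt2 x y \<longrightarrow> lt2 (?f x) (?f y))"
    if "x \<in> A \<union> B" "y \<in> A \<union> B" for x y
    using that disj AB gh g(2) h(2) by (cases "x \<in> A"; cases "y \<in> A"; force)
  then show ?thesis unfolding embeds_def
    by (intro exI[of _ ?f]) (use g(1) h(1) in \<open>auto simp: image_subset_iff\<close>)
qed

section \<open>Permutations as patterns of vertex sets\<close>

lemma perms_iff: "p \<in> perms \<longleftrightarrow> distinct p \<and> set p = {1..length p}"
proof
  assume "p \<in> perms"
  then obtain n where "set p = {1..n}" "distinct p"
    unfolding perms_def by (auto dest: permutations_of_setD)
  moreover from this have "length p = n" by (metis distinct_card card_atLeastAtMost diff_Suc_1)
  ultimately show "distinct p \<and> set p = {1..length p}" by simp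
next
  assume "distinct p \<and> set p = {1..length p}"
  then show "p \<in> perms" unfolding perms_def permutations_of_set_def by auto
qed

text \<open>An entry is its own rank, so the relative order alone determines a permutation.\<close>

lemma perms_nth_eq_card:
  assumes "p \<in> perms" "i < length p"
  shows "p ! i = card {j\<in>{..<length p}. p ! j \<le> p ! i}"
proof -
  have d: "distinct p" "set p = {1..length p}" using assms(1) by (auto simp: perms_iff)
  have "p ! i \<le> length p" using d(2) assms(2) nth_mem by fastforce
  then have "(\<lambda>j. p ! j) ` {j\<in>{..<length p}. p ! j \<le> p ! i} = {1..p ! i}"
    using d(2) by (auto simp: in_set_conv_nth set_eq_iff image_iff) (metis dual_order.trans)+
  moreover have "inj_on (\<lambda>j. p ! j) {j\<in>{..<length p}. p ! j \<le> p ! i}"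
    using d(1) by (auto simp: inj_on_def nth_eq_iff_index_eq)
  ultimately show ?thesis by (metis card_image card_atLeastAtMost diff_Suc_1)
qed

text \<open>A strictly increasing map of an initial segment into itself is the identity; the two
  inductions bound it from below and, counting down from the last position, from above. Equal ranks
  then give equal entries.\<close>

lemma perm_contained_same_length:
  assumes "p \<in> perms" "q \<in> perms" "length p = length q" "perm_contained p q"
  shows "p = q"
proof -
  let ?n = "length p"
  obtain f where f: "strict_mono_on {..<?n} f" "f ` {..<?n} \<subseteq> {..<length q}"
    "\<forall>i<?n. \<forall>j<?n. p ! i < p ! j \<longleftrightarrow> q ! f i < q ! f j"
    using assms(4) unfolding perm_contained_def occurs_in_def by blast
  have "i \<le> f i" if "i < ?n" for i using that
  proof (induction i)
    case (Suc i)
    then have "f i < f (Suc i)" using f(1) by (auto simp: strict_mono_on_def)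
    then show ?case using Suc by simp
  qed simp
  moreover have "f (?n - 1 - k) \<le> ?n - 1 - k" if "k < ?n" for k using that
  proof (induction k)
    case 0
    then have "f (?n - 1) < length q" using f(2) by (auto simp: image_subset_iff)
    then show ?case using assms(3) by simp
  next
    case (Suc k)
    then have "f (?n - 1 - Suc k) < f (?n - 1 - k)"
      using strict_mono_onD[OF f(1), of "?n - 1 - Suc k" "?n - 1 - k"] by simp
    moreover have "f (?n - 1 - k) \<le> ?n - 1 - k" using Suc by simp
    ultimately show ?case using Suc.prems by linarith
  qed
  then have "f i \<le> i" if "i < ?n" for i
  proof -
    have "f (?n - 1 - (?n - 1 - i)) \<le> ?n - 1 - (?n - 1 - i)"
      using that by (intro \<open>\<And>k. k < ?n \<Longrightarrow> f (?n - 1 - k) \<le> ?n - 1 - k\<close>) simp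
    then show ?thesis using that by simp
  qed
  ultimately have id: "f i = i" if "i < ?n" for i using that by (simp add: le_antisym)
  have "p ! i = q ! i" if "i < ?n" for i
  proof -
    have "p ! j \<le> p ! i \<longleftrightarrow> q ! j \<le> q ! i" if "j < ?n" for j
      using f(3) id that \<open>i < ?n\<close> by (metis not_less)
    then have "{j\<in>{..<?n}. p ! j \<le> p ! i} = {j\<in>{..<?n}. q ! j \<le> q ! i}" by auto
    then show ?thesis
      using perms_nth_eq_card[OF assms(1) that] perms_nth_eq_card[OF assms(2), of i] that assms(3)
      by simp
  qed
  then show ?thesis using assms(3) by (simp add: nth_equalityI)
qed

definition pattern_of :: "nat list \<Rightarrow> nat set \<Rightarrow> bool" where
  "pattern_of p V \<longleftrightarrow> p \<in> perms \<and> (\<exists>h. bij_betw h {..<length p} V \<and>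
     (\<forall>i<length p. \<forall>j<length p. (i < j \<longleftrightarrow> lt1 (h i) (h j)) \<and> (p ! i < p ! j \<longleftrightarrow> lt2 (h i) (h j))))"

lemma pattern_of_card: "pattern_of p V \<Longrightarrow> card V = length p"
  unfolding pattern_of_def using bij_betw_same_card by fastforce

lemma SIO_iff_pattern_of:
  "p \<in> SIO \<longleftrightarrow> (\<exists>V. finite V \<and> V \<subseteq> {1..} \<and> pattern_of p V)"
proof
  assume "p \<in> SIO"
  then obtain f where p: "p \<in> perms" and f: "strict_mono_on {..<length p} f"
    "f ` {..<length p} \<subseteq> {1..}" "\<forall>i<length p. \<forall>j<length p. p ! i < p ! j \<longleftrightarrow> osc (f i) < osc (f j)"
    unfolding SIO_def occurs_in_def by blast
  let ?h = "path_index \<circ> f"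
  have pos: "1 \<le> ?h i" if "i < length p" for i
    using that f(2) path_index_pos by (auto simp: image_subset_iff)
  have lt: "i < j \<longleftrightarrow> f i < f j" if "i < length p" "j < length p" for i j
    using f(1) that by (metis lessThan_iff strict_mono_on_less)
  have "pattern_of p (?h ` {..<length p})" unfolding pattern_of_def
  proof (intro conjI exI[of _ ?h] allI impI)
    show "bij_betw ?h {..<length p} (?h ` {..<length p})"
      using strict_mono_on_imp_inj_on[OF f(1)] inj_path_index
      by (intro inj_on_imp_bij_betw comp_inj_on) (auto intro: inj_on_subset)
    fix i j assume ij: "i < length p" "j < length p"
    show "i < j \<longleftrightarrow> lt1 (?h i) (?h j)"
      using lt[OF ij] path_index_less[OF pos pos] ij by (simp add: path_index_involution)
    show "p ! i < p ! j \<longleftrightarrow> lt2 (?h i) (?h j)"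
      using f(3) osc_path_index_less[OF pos pos] ij by (simp add: path_index_involution)
  qed (fact p)
  then show "\<exists>V. finite V \<and> V \<subseteq> {1..} \<and> pattern_of p V"
    using pos by (intro exI[of _ "?h ` {..<length p}"]) auto
next
  assume "\<exists>V. finite V \<and> V \<subseteq> {1..} \<and> pattern_of p V"
  then obtain V h where V: "V \<subseteq> {1..}" "p \<in> perms" "bij_betw h {..<length p} V" and
    h: "\<forall>i<length p. \<forall>j<length p. (i < j \<longleftrightarrow> lt1 (h i) (h j)) \<and> (p ! i < p ! j \<longleftrightarrow> lt2 (h i) (h j))"
    unfolding pattern_of_def by blast
  have pos: "1 \<le> h i" if "i < length p" for i
    using V that by (auto simp: bij_betw_def)
  have "occurs_in p {1..} osc" unfolding occurs_in_def
    by (rule exI[of _ "path_index \<circ> h"])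
      (use pos h path_index_less osc_path_index_less path_index_pos in
        \<open>auto simp: strict_mono_on_def\<close>)
  then show "p \<in> SIO" using V(2) by (simp add: SIO_def)
qed

lemma ex_pattern_of:
  assumes "finite V" "V \<subseteq> {1..}"
  shows "\<exists>p. pattern_of p V"
proof -
  define xs where "xs = sorted_list_of_set (path_index ` V)"
  define rank where "rank v = card {j \<in> V. j = v \<or> lt2 j v}" for v
  define p where "p = map (\<lambda>i. rank (path_index i)) xs"
  let ?h = "\<lambda>i. path_index (xs ! i)"
  have xs: "set xs = path_index ` V" "sorted_wrt (<) xs"
    using assms(1) by (auto simp: xs_def)
  have len: "length xs = card V"
    unfolding xs_def by (simp add: card_image inj_on_subset[OF inj_path_index])
  have hV: "?h i \<in> V" if "i < length xs" for i
    using nth_mem[OF that] xs(1) by (auto simp: path_index_involution)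
  have pos: "1 \<le> v" if "v \<in> V" for v using that assms(2) by auto
  \<comment> \<open>Transitivity is inherited from the order of the values in the
    oscillation.\<close>
  have trans: "lt2 u w" if "lt2 u v" "lt2 v w" "u \<in> V" "v \<in> V" "w \<in> V" for u v w
    using that osc_path_index_less[OF pos pos, of u v] osc_path_index_less[OF pos pos, of v w]
      osc_path_index_less[OF pos pos, of u w] by auto
  have rank_less: "rank u < rank v \<longleftrightarrow> lt2 u v" if "u \<in> V" "v \<in> V" for u v
  proof -
    have *: "rank u < rank v" if "lt2 u v" "u \<in> V" "v \<in> V" for u v
    proof -
      have "{j \<in> V. j = u \<or> lt2 j u} \<subseteq> {j \<in> V. j = v \<or> lt2 j v}"
        using that trans by blast
      moreover have "v \<in> {j \<in> V. j = v \<or> lt2 j v}" "v \<notin> {j \<in> V. j = u \<or> lt2 j u}"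
        using that lt2_asym by auto
      ultimately have "{j \<in> V. j = u \<or> lt2 j u} \<subset> {j \<in> V. j = v \<or> lt2 j v}" by blast
      then show ?thesis unfolding rank_def using assms(1) by (intro psubset_card_mono) auto
    qed
    show ?thesis using *[of u v] *[of v u] lt2_total[of u v] that
      by (cases "u = v") auto
  qed
  have rank_range: "rank v \<in> {1..card V}" if "v \<in> V" for v
  proof -
    have "{v} \<subseteq> {j \<in> V. j = v \<or> lt2 j v}" using that by auto
    then have "card {v} \<le> rank v" unfolding rank_def using assms(1) by (intro card_mono) auto
    moreover have "rank v \<le> card V" unfolding rank_def using assms(1) by (intro card_mono) auto
    ultimately show ?thesis by simp
  qed
  have inj: "inj_on rank V"
  proof (rule inj_onI, rule ccontr)
    fix u v assume "u \<in> V" "v \<in> V" "rank u = rank v" "u \<noteq> v"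
    then show False using rank_less[of u v] rank_less[of v u] lt2_total[of u v] by simp
  qed
  have "rank ` V = {1..card V}"
    using rank_range inj by (intro card_subset_eq) (auto simp: card_image)
  then have "set p = {1..length p}" unfolding p_def using xs(1) len
    by (simp add: image_image path_index_involution)
  moreover from this have "distinct p"
    by (metis card_atLeastAtMost card_distinct diff_Suc_1)
  ultimately have "p \<in> perms" by (simp add: perms_iff)
  moreover have "bij_betw ?h {..<length p} V"
  proof -
    have "bij_betw (\<lambda>i. xs ! i) {..<length xs} (set xs)"
      using xs(2) by (intro bij_betw_nth) (auto simp: strict_sorted_iff)
    moreover have "bij_betw path_index (set xs) V"
      unfolding xs(1) by (rule bij_betw_byWitness[of _ path_index]) (auto simp: path_index_involution)
    ultimately show ?thesis using bij_betw_trans by (fastforce simp: p_def comp_def)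
  qed
  moreover have "(i < j \<longleftrightarrow> lt1 (?h i) (?h j)) \<and> (p ! i < p ! j \<longleftrightarrow> lt2 (?h i) (?h j))"
    if ij: "i < length p" "j < length p" for i j
  proof
    have l: "i < length xs" "j < length xs" using ij by (auto simp: p_def)
    have "i < j \<longleftrightarrow> xs ! i < xs ! j"
      using l sorted_wrt_nth_less[OF xs(2), of i j] sorted_wrt_nth_less[OF xs(2), of j i]
      by (cases i j rule: linorder_cases) auto
    then show "i < j \<longleftrightarrow> lt1 (?h i) (?h j)"
      using path_index_less[OF pos[OF hV[OF l(1)]] pos[OF hV[OF l(2)]]]
      by (simp add: path_index_involution)
    show "p ! i < p ! j \<longleftrightarrow> lt2 (?h i) (?h j)"
      using rank_less[OF hV[OF l(1)] hV[OF l(2)]] l by (simp add: p_def)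
  qed
  ultimately show ?thesis unfolding pattern_of_def by blast
qed

lemma perm_contained_iff_embeds:
  assumes "pattern_of p V" "pattern_of q W"
  shows "perm_contained p q \<longleftrightarrow> embeds V W"
proof -
  obtain h where p: "p \<in> perms" "bij_betw h {..<length p} V" and
    h: "\<And>i j. i < length p \<Longrightarrow> j < length p \<Longrightarrow> (i < j \<longleftrightarrow> lt1 (h i) (h j)) \<and> (p ! i < p ! j \<longleftrightarrow> lt2 (h i) (h j))"
    using assms(1) unfolding pattern_of_def by blast
  obtain k where q: "q \<in> perms" "bij_betw k {..<length q} W" and
    k: "\<And>i j. i < length q \<Longrightarrow> j < length q \<Longrightarrow> (i < j \<longleftrightarrow> lt1 (k i) (k j)) \<and> (q ! i < q ! j \<longleftrightarrow> lt2 (k i) (k j))"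
    using assms(2) unfolding pattern_of_def by blast
  have hinv: "h i \<in> V" "inv_into {..<length p} h (h i) = i" if "i < length p" for i
    using p(2) that by (auto simp: bij_betw_def)
  have kinv: "inv_into {..<length q} k y < length q" "k (inv_into {..<length q} k y) = y" if "y \<in> W" for y
    using q(2) that bij_betw_inv_into_right[OF q(2)] inv_into_into[of y k "{..<length q}"]
    by (auto simp: bij_betw_def)
  show ?thesis
  proof
    assume "perm_contained p q"
    then obtain f where f: "strict_mono_on {..<length p} f" "f ` {..<length p} \<subseteq> {..<length q}"
      "\<forall>i<length p. \<forall>j<length p. p ! i < p ! j \<longleftrightarrow> q ! f i < q ! f j"
      unfolding perm_contained_def occurs_in_def by blast
    have fq: "f i < length q" if "i < length p" for i using f(2) that by auto
    have fm: "f i < f j" if "i < length p" "j < length p" "i < j" for i j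
      using f(1) that by (auto simp: strict_mono_on_def)
    let ?g = "\<lambda>x. k (f (inv_into {..<length p} h x))"
    have V: "V = h ` {..<length p}" using p(2) by (simp add: bij_betw_def)
    have "?g ` V \<subseteq> W" using fq q(2) hinv by (auto simp: V bij_betw_def)
    moreover have "(lt1 x y \<longrightarrow> lt1 (?g x) (?g y)) \<and> (lt2 x y \<longrightarrow> lt2 (?g x) (?g y))"
      if xy: "x \<in> V" "y \<in> V" for x y
    proof -
      obtain i j where ij: "x = h i" "y = h j" "i < length p" "j < length p"
        using xy by (auto simp: V)
      show ?thesis using h[OF ij(3,4)] k[OF fq fq, OF ij(3,4)] fm[OF ij(3,4)] f(3) ij hinv(2) by metis
    qed
    ultimately show "embeds V W" unfolding embeds_def by blast
  next
    assume "embeds V W"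
    then obtain g where g: "g ` V \<subseteq> W"
      "\<forall>x\<in>V. \<forall>y\<in>V. (lt1 x y \<longrightarrow> lt1 (g x) (g y)) \<and> (lt2 x y \<longrightarrow> lt2 (g x) (g y))"
      unfolding embeds_def by blast
    let ?f = "\<lambda>i. inv_into {..<length q} k (g (h i))"
    have gW: "g (h i) \<in> W" if "i < length p" for i using g(1) hinv that by auto
    have fq: "?f i < length q" "k (?f i) = g (h i)" if "i < length p" for i using kinv[OF gW[OF that]] by auto
    have mono: "?f i < ?f j" if "i < length p" "j < length p" "i < j" for i j
      using h[OF that(1,2)] that k[OF fq(1) fq(1), OF that(1,2)] fq(2) g(2) hinv(1) by metis
    have less: "q ! ?f i < q ! ?f j" if "i < length p" "j < length p" "p ! i < p ! j" for i j
      using h[OF that(1,2)] that k[OF fq(1) fq(1), OF that(1,2)] fq(2) g(2) hinv(1) by metis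
    have "p ! i < p ! j \<longleftrightarrow> q ! ?f i < q ! ?f j" if "i < length p" "j < length p" for i j
    proof -
      have "i = j \<or> p ! i < p ! j \<or> p ! j < p ! i"
        using p(1) that by (metis linorder_neqE_nat nth_eq_iff_index_eq perms_iff)
      then show ?thesis using less[OF that] less[OF that(2,1)] by force
    qed
    then show "perm_contained p q" unfolding perm_contained_def occurs_in_def
      using mono fq(1) by (intro exI[of _ ?f]) (auto simp: strict_mono_on_def)
  qed
qed

lemma pattern_of_unique:
  assumes "pattern_of p V" "pattern_of q W" "embeds V W" "card V = card W"
  shows "p = q"
  using assms perm_contained_iff_embeds[OF assms(1,2)] perm_contained_same_length
    pattern_of_card unfolding pattern_of_def by metis

section \<open>Words\<close>

text \<open>These pairs are the inversions, that is, the edges of the path; the odd end of an edge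
  always comes first by position.\<close>

lemma lt1_lt2_converse: "lt1 a b \<and> lt2 b a \<longleftrightarrow> odd a \<and> (b = Suc a \<or> a = Suc b)"
  by (auto simp: lt1_def lt2_def)

text \<open>Inversions go to inversions, hence edges to edges. As the odd end is the earlier one by
  position, parities are kept too.\<close>

lemma adjacent_image:
  assumes g: "\<And>x y. x \<in> V \<Longrightarrow> y \<in> V \<Longrightarrow> (lt1 x y \<longrightarrow> lt1 (g x) (g y)) \<and> (lt2 x y \<longrightarrow> lt2 (g x) (g y))"
    and x: "x \<in> V" "Suc x \<in> V"
  shows "(g (Suc x) = Suc (g x) \<or> g x = Suc (g (Suc x))) \<and> (odd (g x) \<longleftrightarrow> odd x)"
proof (cases "odd x")
  case True
  then have "lt1 x (Suc x) \<and> lt2 (Suc x) x" unfolding lt1_lt2_converse by simp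
  then have "lt1 (g x) (g (Suc x)) \<and> lt2 (g (Suc x)) (g x)" using g[OF x] g[OF x(2,1)] by metis
  then show ?thesis using True unfolding lt1_lt2_converse by metis
next
  case False
  then have "lt1 (Suc x) x \<and> lt2 x (Suc x)" unfolding lt1_lt2_converse by simp
  then have "lt1 (g (Suc x)) (g x) \<and> lt2 (g x) (g (Suc x))" using g[OF x] g[OF x(2,1)] by metis
  then have "odd (g (Suc x)) \<and> (g x = Suc (g (Suc x)) \<or> g (Suc x) = Suc (g x))"
    unfolding lt1_lt2_converse .
  then show ?thesis using False by (metis even_Suc)
qed

text \<open>From three vertices on, a run cannot fold back: \<open>x\<close> and
  \<open>x + 2\<close> are not inverted, so their images are at least 2 apart in the same direction,
  and every step goes up by one. Two vertices may be exchanged, which lets the image start at the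
  other parity.\<close>

lemma run_image:
  assumes g: "\<And>x y. x \<in> V \<Longrightarrow> y \<in> V \<Longrightarrow> (lt1 x y \<longrightarrow> lt1 (g x) (g y)) \<and> (lt2 x y \<longrightarrow> lt2 (g x) (g y))"
    and V: "{s..<s + k} \<subseteq> V" and k: "1 \<le> k"
  shows "\<exists>y. g ` {s..<s + k} = {y..<y + k} \<and> (3 \<le> k \<longrightarrow> odd y = odd s)"
proof -
  consider "k = 1" | "k = 2" | "3 \<le> k" using k by linarith
  then show ?thesis
  proof cases
    case 1
    then show ?thesis by auto
  next
    case 2
    then have "{s..<s + k} = {s, Suc s}" by auto
    then show ?thesis using adjacent_image[of V g s, OF g] V 2
      by (auto intro: exI[of _ "g s"] exI[of _ "g (Suc s)"])
  next
    case 3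
    have triple: "g (Suc x) = Suc (g x)" "g (Suc (Suc x)) = Suc (Suc (g x))"
      if "s \<le> x" "x + 2 < s + k" for x
    proof -
      have x: "x \<in> V" "Suc x \<in> V" "Suc (Suc x) \<in> V" using V that by auto
      have "lt1 x (Suc (Suc x)) \<and> lt2 x (Suc (Suc x))" by (simp add: lt1_lt2)
      then have "g x + 2 \<le> g (Suc (Suc x))" using g x lt1_lt2 by blast
      then show "g (Suc x) = Suc (g x)" "g (Suc (Suc x)) = Suc (Suc (g x))"
        using adjacent_image[of V g x, OF g] adjacent_image[of V g "Suc x", OF g] x by auto
    qed
    have shift: "d < k \<Longrightarrow> g (s + d) = g s + d" for d
    proof (induction d)
      case (Suc d)
      show ?case
      proof (cases d)
        case 0
        then show ?thesis using triple(1)[of s] 3 by simp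
      next
        case (Suc e)
        then show ?thesis using Suc.IH Suc.prems triple[of "s + e"] by simp
      qed
    qed simp
    have "g ` {s..<s + k} = {g s..<g s + k}"
    proof -
      have *: "{x..<x + k} = (+) x ` {0..<k}" for x :: nat
        by (simp add: add.commute)
      show ?thesis unfolding * image_image using shift by (intro image_cong) auto
    qed
    moreover have "s \<in> V" "Suc s \<in> V" using V 3 by auto
    then have "odd (g s) = odd s" using adjacent_image[of V g s, OF g] by blast
    ultimately show ?thesis by blast
  qed
qed

lemma embeds_run:
  assumes "3 \<le> k \<Longrightarrow> odd y = odd s" "1 \<le> k"
  shows "embeds {s..<s + k} {y..<y + k}"
proof (cases "k = 2 \<and> odd y \<noteq> odd s")
  case True
  then have "{s..<s + k} = {s, Suc s}" "{y..<y + k} = {y, Suc y}" by auto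
  \<comment> \<open>Exchanging the two vertices keeps the parity of each, although the runs start at
    different parities.\<close>
  then show ?thesis using True unfolding embeds_def lt1_def lt2_def
    by (intro exI[of _ "\<lambda>x. if x = s then Suc y else y"]) auto
next
  case False
  then consider "k = 1" | "odd y = odd s" using assms by linarith
  then show ?thesis
  proof cases
    case 1
    then show ?thesis unfolding embeds_def lt1_def lt2_def by (intro exI[of _ "\<lambda>x. y"]) auto
  next
    case 2
    have par: "odd (y + (x - s)) = odd x" if "s \<le> x" for x using 2 that by auto
    have "(\<lambda>x. y + (x - s)) ` {s..<s + k} \<subseteq> {y..<y + k}" by auto
    moreover have "(lt1 x z \<longrightarrow> lt1 (y + (x - s)) (y + (z - s))) \<and> (lt2 x z \<longrightarrow> lt2 (y + (x - s)) (y + (z - s)))"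
      if "x \<in> {s..<s + k}" "z \<in> {s..<s + k}" for x z
      using that par[of x] par[of z] unfolding lt1_def lt2_def by (auto simp del: even_add odd_add)
    ultimately show ?thesis unfolding embeds_def by blast
  qed
qed

text \<open>
  A letter \<open>(k, t)\<close> stands for a sum-indecomposable component of size \<open>k\<close>: a run of \<open>k\<close>
  consecutive path vertices, starting at an odd vertex iff \<open>t\<close>. Runs of one or two vertices give
  the same permutation for both parities, so that canonical words fix \<open>t = False\<close> for them.
\<close>

type_synonym word = "(nat \<times> bool) list"

definition valid :: "word \<Rightarrow> bool" where
  "valid w \<longleftrightarrow> (\<forall>(k, t)\<in>set w. 1 \<le> k)"

definition canonical :: "word \<Rightarrow> bool" where
  "canonical w \<longleftrightarrow> (\<forall>(k, t)\<in>set w. 1 \<le> k \<and> (t \<longrightarrow> 3 \<le> k))"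

abbreviation size_of :: "word \<Rightarrow> nat" where
  "size_of w \<equiv> sum_list (map fst w)"

lemma valid_simps [simp]: "valid []" "valid ((k, t) # w) \<longleftrightarrow> 1 \<le> k \<and> valid w"
  "valid (u @ v) \<longleftrightarrow> valid u \<and> valid v"
  by (auto simp: valid_def)

lemma canonical_simps [simp]: "canonical []"
  "canonical ((k, t) # w) \<longleftrightarrow> 1 \<le> k \<and> (t \<longrightarrow> 3 \<le> k) \<and> canonical w"
  "canonical (u @ v) \<longleftrightarrow> canonical u \<and> canonical v"
  by (auto simp: canonical_def)

lemma canonical_imp_valid: "canonical w \<Longrightarrow> valid w"
  by (auto simp: canonical_def valid_def)

definition start :: "nat \<Rightarrow> bool \<Rightarrow> nat" where
  "start b t = (if odd b = t then b else Suc b)"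

lemma start_props: "odd (start b t) = t" "b \<le> start b t" "start b t \<le> Suc b"
  by (auto simp: start_def)

text \<open>The leftmost realisation of a word from \<open>b\<close> on: the \<open>+ 1\<close>
  leaves out the separating vertex, and \<open>start\<close> skips a second one if the parity
  requires it.\<close>

fun place :: "nat \<Rightarrow> word \<Rightarrow> nat set" where
  "place b [] = {}"
| "place b ((k, t) # w) = {start b t..<start b t + k} \<union> place (start b t + k + 1) w"

lemma place_ge: "place b w \<subseteq> {b..}"
proof (induction b w rule: place.induct)
  case (2 b k t w)
  then show ?case using start_props(2)[of b t] by fastforce
qed simp

lemma finite_place [simp]: "finite (place b w)"
  by (induction b w rule: place.induct) auto

lemma card_place: "card (place b w) = size_of w"
proof (induction b w rule: place.induct)
  case (2 b k t w)
  have "{start b t..<start b t + k} \<inter> place (start b t + k + 1) w = {}"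
    using place_ge[of "start b t + k + 1" w] by fastforce
  then show ?case using 2 by (simp add: card_Un_disjoint)
qed simp

text \<open>An embedding reduced to the start \<open>y\<close> of each image run. The vertex
  \<open>y + k\<close> is withheld from the rest, so that consecutive components stay separated;
  parity matters only from size 3 on.\<close>

fun has :: "nat set \<Rightarrow> word \<Rightarrow> bool" where
  "has V [] = True"
| "has V ((k, t) # w) = (\<exists>y. {y..<y + k} \<subseteq> V \<and> (3 \<le> k \<longrightarrow> odd y = t) \<and> has (V \<inter> {y + k<..}) w)"

lemma has_mono: "has V w \<Longrightarrow> V \<subseteq> W \<Longrightarrow> has W w"
proof (induction w arbitrary: V W)
  case (Cons p w)
  obtain k t where p: "p = (k, t)" by force
  from Cons.prems(1) obtain y where "{y..<y + k} \<subseteq> V" "3 \<le> k \<longrightarrow> odd y = t" "has (V \<inter> {y + k<..}) w"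
    unfolding p by auto
  moreover have "has (W \<inter> {y + k<..}) w"
    using Cons.IH[OF \<open>has (V \<inter> {y + k<..}) w\<close>] Cons.prems(2) by blast
  ultimately show ?case using Cons.prems(2) unfolding p has.simps by blast
qed simp

text \<open>By \<open>run_image\<close> the image of the first component is again a run, and
  \<open>lt1_lt2\<close> carries the distance of at least 2 to all later vertices over to their
  images. An embedding thus amounts to a choice of start vertices.\<close>

lemma embeds_place_iff: "valid w \<Longrightarrow> embeds (place b w) V \<longleftrightarrow> has V w"
proof (induction w arbitrary: b V)
  case Nil
  then show ?case by (simp add: embeds_def)
next
  case (Cons p w)
  obtain k t where p: "p = (k, t)" by force
  define s where "s = start b t"
  have k: "1 \<le> k" and w: "valid w" using Cons.prems p by auto
  have place: "place b (p # w) = {s..<s + k} \<union> place (s + k + 1) w" by (simp add: p s_def)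
  have odd_s: "odd s = t" unfolding s_def by (rule start_props)
  show ?case
  proof
    assume "embeds (place b (p # w)) V"
    then obtain g where gV: "g ` place b (p # w) \<subseteq> V" and g:
      "\<And>x y. x \<in> place b (p # w) \<Longrightarrow> y \<in> place b (p # w) \<Longrightarrow>
        (lt1 x y \<longrightarrow> lt1 (g x) (g y)) \<and> (lt2 x y \<longrightarrow> lt2 (g x) (g y))"
      unfolding embeds_def by blast
    have "\<exists>y. g ` {s..<s + k} = {y..<y + k} \<and> (3 \<le> k \<longrightarrow> odd y = odd s)"
      by (rule run_image[of "place b (p # w)" g s k, OF g _ k]) (auto simp: place)
    then obtain y where y: "g ` {s..<s + k} = {y..<y + k}" "3 \<le> k \<longrightarrow> odd y = odd s" by blast
    have "y + k - 1 \<in> g ` {s..<s + k}" using y k by auto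
    then obtain x where x: "x \<in> {s..<s + k}" "g x = y + k - 1" by auto
    have "y + k < g z" if "z \<in> place (s + k + 1) w" for z
    proof -
      have "x + 2 \<le> z" using place_ge[of "s + k + 1" w] that x(1) by fastforce
      then have "lt1 x z \<and> lt2 x z" by (simp only: lt1_lt2)
      then have "lt1 (g x) (g z) \<and> lt2 (g x) (g z)" using g[of x z] x that by (auto simp: place)
      then have "g x + 2 \<le> g z" by (simp only: lt1_lt2)
      then show ?thesis using x k by auto
    qed
    then have "g ` place (s + k + 1) w \<subseteq> V \<inter> {y + k<..}" using gV by (auto simp: place)
    then have "embeds (place (s + k + 1) w) (V \<inter> {y + k<..})"
      unfolding embeds_def using g by (intro exI[of _ g]) (auto simp: place)
    then have "has (V \<inter> {y + k<..}) w" using Cons.IH[OF w] by blast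
    moreover have "{y..<y + k} \<subseteq> V" using gV unfolding y(1)[symmetric] place by blast
    ultimately show "has V (p # w)" using y(2) odd_s unfolding p has.simps by blast
  next
    assume "has V (p # w)"
    then obtain y where y: "{y..<y + k} \<subseteq> V" "3 \<le> k \<longrightarrow> odd y = t" "has (V \<inter> {y + k<..}) w"
      unfolding p by auto
    have "embeds (place (s + k + 1) w) (V \<inter> {y + k<..})" using Cons.IH[OF w] y(3) by blast
    moreover have "embeds {s..<s + k} {y..<y + k}"
      using y(2) odd_s k by (intro embeds_run) auto
    moreover have "a + 2 \<le> c" if "a \<in> {s..<s + k}" "c \<in> place (s + k + 1) w" for a c
      using that place_ge[of "s + k + 1" w] by fastforce
    ultimately have "embeds (place b (p # w)) ({y..<y + k} \<union> (V \<inter> {y + k<..}))"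
      unfolding place by (intro embeds_Un) auto
    moreover have "embeds ({y..<y + k} \<union> (V \<inter> {y + k<..})) V"
      using y(1) by (intro embeds_mono) blast
    ultimately show "embeds (place b (p # w)) V" by (rule embeds_trans)
  qed
qed

lemma has_place: "valid w \<Longrightarrow> has (place b w) w"
  using embeds_place_iff embeds_mono by blast

lemma has_trans: "valid u \<Longrightarrow> valid v \<Longrightarrow> has (place b v) u \<Longrightarrow> has V v \<Longrightarrow> has V u"
  using embeds_trans[of "place 1 u" "place b v" V] embeds_place_iff[of u 1] embeds_place_iff[of v b]
  by simp

lemma size_le_card_if_has:
  assumes "valid w" "has V w" "finite V"
  shows "size_of w \<le> card V"
proof -
  have "embeds (place 1 w) V" using assms embeds_place_iff by blast
  then obtain g where g: "g ` place 1 w \<subseteq> V" "\<forall>x\<in>place 1 w. \<forall>y\<in>place 1 w. lt1 x y \<longrightarrow> lt1 (g x) (g y)"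
    unfolding embeds_def by blast
  have "inj_on g (place 1 w)"
  proof (rule inj_onI, rule ccontr)
    fix x y assume "x \<in> place 1 w" "y \<in> place 1 w" "g x = g y" "x \<noteq> y"
    then have "lt1 (g x) (g x)" using g(2) lt1_total[of x y] by metis
    then show False by (simp add: lt1_def)
  qed
  then show ?thesis using g(1) assms(3) by (metis card_inj_on_le card_place)
qed

text \<open>No vertex can be spared: sizes agree, so the first component must fill exactly the first
  run of \<open>place b w'\<close>. Canonicity then settles the parity flag of a component of size 1
  or 2.\<close>

lemma has_place_imp_eq:
  "canonical w \<Longrightarrow> canonical w' \<Longrightarrow> size_of w = size_of w' \<Longrightarrow> has (place b w') w \<Longrightarrow> w = w'"
proof (induction w arbitrary: b w')
  case Nil
  then show ?case by (cases w') auto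
next
  case (Cons p w)
  obtain k t where p: "p = (k, t)" by force
  have "w' \<noteq> []" using Cons.prems p by auto
  then obtain l u w'' where w': "w' = (l, u) # w''" by (metis list.exhaust prod.exhaust)
  define s where "s = start b u"
  define V where "V = place b w'"
  have V: "V = {s..<s + l} \<union> place (s + l + 1) w''" by (simp add: V_def w' s_def)
  have Vge: "x \<in> {s..<s + l} \<or> s + l < x" if "x \<in> V" for x
    using that place_ge[of "s + l + 1" w''] unfolding V by auto
  have finV: "finite V" by (simp add: V_def)
  have kl: "1 \<le> k" "1 \<le> l" using Cons.prems p w' by auto
  obtain y where y: "{y..<y + k} \<subseteq> V" "3 \<le> k \<longrightarrow> odd y = t" "has (V \<inter> {y + k<..}) w"
    using Cons.prems(4) unfolding p V_def by auto
  have "size_of w \<le> card (V \<inter> {y + k<..})"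
    using Cons.prems(1) finV y(3) p by (intro size_le_card_if_has canonical_imp_valid) auto
  moreover have "card V = k + size_of w"
    using Cons.prems(3) p card_place[of b w'] by (simp add: V_def)
  moreover have "card V = card (V \<inter> {..y + k}) + card (V \<inter> {y + k<..})"
    using finV by (subst card_Un_disjoint[symmetric]) (auto intro!: arg_cong[of _ _ card])
  ultimately have few: "card (V \<inter> {..y + k}) \<le> k" by linarith
  have sub: "{y..<y + k} \<subseteq> V \<inter> {..y + k}" using y(1) by auto
  have eq: "V \<inter> {..y + k} = {y..<y + k}"
    using card_subset_eq[OF _ sub] card_mono[OF _ sub] few finV by auto
  have "y \<in> V" using y(1) kl by auto
  then have "s \<le> y" using Vge[of y] by auto
  then have "s \<in> V \<inter> {..y + k}" using kl by (auto simp: V)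
  then have sy: "s = y" using eq \<open>s \<le> y\<close> by auto
  have "s + l \<notin> V" using Vge[of "s + l"] by auto
  then have "k \<le> l" using y(1) sy by (metis atLeastLessThan_iff le_add1 nat_add_left_cancel_less not_le subsetD)
  moreover have "\<not> k < l"
  proof
    assume "k < l"
    then have "y + k \<in> V \<inter> {..y + k}" using sy by (auto simp: V)
    then show False using eq by auto
  qed
  ultimately have "k = l" by simp
  moreover have "t = u"
  proof (cases "3 \<le> k")
    case True
    then show ?thesis using y(2) sy start_props(1)[of b u] by (simp add: s_def)
  next
    case False
    then show ?thesis using Cons.prems(1,2) p w' \<open>k = l\<close> by auto
  qed
  moreover have "V \<inter> {y + k<..} = place (s + l + 1) w''"
    using place_ge[of "s + l + 1" w''] \<open>k = l\<close> sy unfolding V by auto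
  then have "w = w''"
    using Cons.IH[of w'' "s + l + 1"] Cons.prems p w' y(3) \<open>k = l\<close> by simp
  ultimately show ?case by (simp add: p w')
qed

lemma ex_maximal_run:
  fixes V :: "nat set"
  assumes "finite V" "V \<noteq> {}"
  obtains k where "1 \<le> k" "{Min V..<Min V + k} \<subseteq> V" "Min V + k \<notin> V"
    "V - {Min V..<Min V + k} \<subseteq> {Min V + k<..}"
proof -
  define m where "m = Min V"
  have m: "m \<in> V" "\<And>x. x \<in> V \<Longrightarrow> m \<le> x" using assms by (auto simp: m_def)
  have "\<exists>k. m + k \<notin> V" using Max_ge[OF assms(1), of "m + Suc (Max V)"]
    by (intro exI[of _ "Suc (Max V)"]) auto
  then obtain k where k: "m + k \<notin> V" "\<And>j. j < k \<Longrightarrow> m + j \<in> V"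
    using exists_least_iff[of "\<lambda>k. m + k \<notin> V"] by blast
  have "1 \<le> k" using k(1) m(1) by (cases k) auto
  moreover have run: "{m..<m + k} \<subseteq> V"
  proof
    fix x assume "x \<in> {m..<m + k}"
    then show "x \<in> V" using k(2)[of "x - m"] by auto
  qed
  moreover have "V - {m..<m + k} \<subseteq> {m + k<..}"
  proof
    fix x assume x: "x \<in> V - {m..<m + k}"
    then have "m \<le> x" "x \<noteq> m + k" using m(2) k(1) by auto
    then show "x \<in> {m + k<..}" using x by auto
  qed
  ultimately show thesis using that k(1) by (auto simp: m_def)
qed

lemma ex_canonical_has:
  "finite V \<Longrightarrow> \<exists>w. canonical w \<and> size_of w = card V \<and> has V w"
proof (induction "card V" arbitrary: V rule: less_induct)
  case less
  show ?case
  proof (cases "V = {}")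
    case True
    then show ?thesis by (intro exI[of _ "[]"]) auto
  next
    case False
    then obtain k where k: "1 \<le> k" "{Min V..<Min V + k} \<subseteq> V" "V - {Min V..<Min V + k} \<subseteq> {Min V + k<..}"
      using ex_maximal_run[OF less.prems] by metis
    let ?V = "V - {Min V..<Min V + k}"
    have card: "card ?V = card V - k" "k \<le> card V"
      using card_Diff_subset[of "{Min V..<Min V + k}" V] card_mono[OF less.prems k(2)] k(2) by auto
    then have "card ?V < card V" using k(1) by linarith
    then obtain w where w: "canonical w" "size_of w = card ?V" "has ?V w"
      using less.hyps less.prems by (metis finite_Diff)
    have "has (V \<inter> {Min V + k<..}) w" using has_mono[OF w(3)] k(3) by blast
    then have "has V ((k, 3 \<le> k \<and> odd (Min V)) # w)" using k(2) by auto
    then show ?thesis using w k(1) card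
      by (intro exI[of _ "(k, 3 \<le> k \<and> odd (Min V)) # w"]) auto
  qed
qed

definition perm_of :: "word \<Rightarrow> nat list" where
  "perm_of w = (SOME p. pattern_of p (place 1 w))"

lemma perm_of: "pattern_of (perm_of w) (place 1 w)"
  unfolding perm_of_def by (rule someI_ex, rule ex_pattern_of) (use place_ge in auto)

lemma perm_contained_perm_of:
  "valid u \<Longrightarrow> perm_contained (perm_of u) (perm_of w) \<longleftrightarrow> has (place 1 w) u"
  by (simp add: perm_contained_iff_embeds[OF perm_of perm_of] embeds_place_iff)

definition canonical_words :: "nat \<Rightarrow> word set" where
  "canonical_words n = {w. canonical w \<and> size_of w = n}"

text \<open>Surjectivity comes from splitting a vertex set into maximal runs, injectivity from
  \<open>has_place_imp_eq\<close>. From here on, counting in SIO is counting words.\<close>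

lemma bij_betw_perm_of: "bij_betw perm_of (canonical_words n) (of_size SIO n)"
proof (rule bij_betw_imageI)
  show "inj_on perm_of (canonical_words n)"
  proof (rule inj_onI)
    fix u v assume uv: "u \<in> canonical_words n" "v \<in> canonical_words n" "perm_of u = perm_of v"
    then have "has (place 1 v) u"
      using perm_contained_perm_of[of u v] perm_contained_perm_of[of v v] has_place[of v 1]
        canonical_imp_valid by (auto simp: canonical_words_def)
    then show "u = v" using uv by (intro has_place_imp_eq[of u v 1]) (auto simp: canonical_words_def)
  qed
  show "perm_of ` canonical_words n = of_size SIO n"
  proof (intro equalityI subsetI)
    fix p assume "p \<in> perm_of ` canonical_words n"
    then obtain w where w: "p = perm_of w" "w \<in> canonical_words n" by blast
    have "p \<in> SIO" unfolding SIO_iff_pattern_of w(1)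
      using perm_of[of w] place_ge[of 1 w] by (intro exI[of _ "place 1 w"]) auto
    moreover have "length p = n"
      using pattern_of_card[OF perm_of[of w]] w by (simp add: card_place canonical_words_def)
    ultimately show "p \<in> of_size SIO n" by (simp add: of_size_def)
  next
    fix p assume "p \<in> of_size SIO n"
    then obtain V where V: "finite V" "pattern_of p V" "length p = n"
      unfolding of_size_def SIO_iff_pattern_of by auto
    obtain w where w: "canonical w" "size_of w = card V" "has V w"
      using ex_canonical_has[OF V(1)] by blast
    have "embeds (place 1 w) V" using w embeds_place_iff canonical_imp_valid by blast
    then have "perm_of w = p"
      using pattern_of_unique[OF perm_of V(2)] w(2) by (simp add: card_place)
    moreover have "w \<in> canonical_words n"
      using w V pattern_of_card[OF V(2)] by (simp add: canonical_words_def)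
    ultimately show "p \<in> perm_of ` canonical_words n" by blast
  qed
qed

section \<open>Reflecting the part between two components of size 3\<close>

text \<open>
  The sets \<open>place b w\<close> are those in which consecutive runs are separated by one or two missing
  vertices. Unlike canonicity of words, this is stable under reflection.
\<close>

definition spaced :: "nat \<Rightarrow> nat set \<Rightarrow> bool" where
  "spaced b V \<longleftrightarrow> finite V \<and> V \<subseteq> {b..} \<and>
     (\<forall>x. \<forall>y\<in>V. b \<le> Suc x \<longrightarrow> x \<le> y \<longrightarrow> (\<exists>z\<in>V. x \<le> z \<and> z \<le> x + 2))"

lemma spacedI:
  assumes "finite V" "V \<subseteq> {b..}"
    and "\<And>x y. y \<in> V \<Longrightarrow> b \<le> Suc x \<Longrightarrow> x \<le> y \<Longrightarrow> \<exists>z\<in>V. x \<le> z \<and> z \<le> x + 2"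
  shows "spaced b V"
  using assms unfolding spaced_def by blast

lemma spaced_subset: "spaced b V \<Longrightarrow> finite V \<and> V \<subseteq> {b..}"
  unfolding spaced_def by blast

lemma spacedD:
  "spaced b V \<Longrightarrow> y \<in> V \<Longrightarrow> b \<le> Suc x \<Longrightarrow> x \<le> y \<Longrightarrow> \<exists>z\<in>V. x \<le> z \<and> z \<le> x + 2"
  unfolding spaced_def by blast

lemma spaced_place: "valid w \<Longrightarrow> spaced b (place b w)"
proof (induction b w rule: place.induct)
  case (2 b k t w)
  define s where "s = start b t"
  have s: "b \<le> s" "s \<le> Suc b" using start_props by (auto simp: s_def)
  have k: "1 \<le> k" using 2 by simp
  have R: "spaced (s + k + 1) (place (s + k + 1) w)" using 2 by (simp add: s_def)
  have V: "place b ((k, t) # w) = {s..<s + k} \<union> place (s + k + 1) w" by (simp add: s_def)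
  have "\<exists>z\<in>place b ((k, t) # w). x \<le> z \<and> z \<le> x + 2"
    if "y \<in> place b ((k, t) # w)" "b \<le> Suc x" "x \<le> y" for x y
  proof -
    consider "x < s" | "s \<le> x" "x < s + k" | "s + k \<le> x" by linarith
    then show ?thesis
    proof cases
      case 1
      then show ?thesis using k s that unfolding V by (intro bexI[of _ s]) auto
    next
      case 2
      then show ?thesis unfolding V by (intro bexI[of _ x]) auto
    next
      case 3
      then have "y \<in> place (s + k + 1) w" using that unfolding V by auto
      then have "\<exists>z\<in>place (s + k + 1) w. x \<le> z \<and> z \<le> x + 2"
        by (intro spacedD[OF R _ _ that(3)]) (use 3 in auto)
      then show ?thesis unfolding V by blast
    qed
  qed
  then show ?case using place_ge[of b "(k, t) # w"] finite_place by (intro spacedI) blast+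
qed (simp add: spaced_def)

lemma ex_place_eq: "spaced b V \<Longrightarrow> 1 \<le> b \<Longrightarrow> \<exists>w. valid w \<and> place b w = V"
proof (induction "card V" arbitrary: b V rule: less_induct)
  case less
  have fin: "finite V" using less.prems by (simp add: spaced_def)
  show ?case
  proof (cases "V = {}")
    case True
    then show ?thesis by (intro exI[of _ "[]"]) auto
  next
    case False
    define m where "m = Min V"
    obtain k where k: "1 \<le> k" "{m..<m + k} \<subseteq> V" "V - {m..<m + k} \<subseteq> {m + k<..}"
      unfolding m_def by (rule ex_maximal_run[OF fin False])
    let ?V = "V - {m..<m + k}"
    have m: "m \<in> V" "\<And>x. x \<in> V \<Longrightarrow> m \<le> x" using fin False by (auto simp: m_def)
    have "b \<le> m" using spaced_subset[OF less.prems(1)] m(1) by auto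
    \<comment> \<open>Spacing is applied just below \<open>b\<close>, where no vertex of
      \<open>V\<close> lies; this forces the first run to start at \<open>b\<close> or
      \<open>b + 1\<close>.\<close>
    then have "b \<le> Suc (b - 1)" "b - 1 \<le> m" by linarith+
    then have "\<exists>z\<in>V. b - 1 \<le> z \<and> z \<le> b - 1 + 2" by (rule spacedD[OF less.prems(1) m(1)])
    then obtain z where "z \<in> V" "z \<le> b - 1 + 2" by blast
    then have "m \<le> Suc b" using m(2)[of z] less.prems(2) by simp
    then have "m = b \<or> m = Suc b" using \<open>b \<le> m\<close> by linarith
    then have start: "start b (odd m) = m" by (auto simp: start_def)
    have "\<exists>z\<in>?V. x \<le> z \<and> z \<le> x + 2"
      if "y \<in> ?V" "m + k + 1 \<le> Suc x" "x \<le> y" for x y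
    proof -
      have "b \<le> Suc x" using that \<open>b \<le> m\<close> by simp
      then have "\<exists>z\<in>V. x \<le> z \<and> z \<le> x + 2"
        by (intro spacedD[OF less.prems(1) _ _ that(3)]) (use that(1) in auto)
      then obtain z where "z \<in> V" "x \<le> z" "z \<le> x + 2" by blast
      then show ?thesis using that(2) by (intro bexI[of _ z]) auto
    qed
    then have "spaced (m + k + 1) ?V" using fin k(3) by (intro spacedI) auto
    moreover have "m \<in> V - ?V" using m(1) k(1) by auto
    then have "card ?V < card V" using fin by (intro psubset_card_mono) blast+
    ultimately obtain w where w: "valid w" "place (m + k + 1) w = ?V"
      using less.hyps[of ?V "m + k + 1"] by force
    have "place b ((k, odd m) # w) = {m..<m + k} \<union> ?V"
      unfolding place.simps start w(2) ..
    then have "place b ((k, odd m) # w) = V" using k(2) by blast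
    then show ?thesis using w(1) k(1) by (intro exI[of _ "(k, odd m) # w"]) auto
  qed
qed

lemma place_inject: "valid w \<Longrightarrow> valid w' \<Longrightarrow> place b w = place b w' \<Longrightarrow> w = w'"
proof (induction w arbitrary: b w')
  case Nil
  then show ?case by (cases w') auto
next
  case (Cons p w)
  obtain k t where p: "p = (k, t)" by force
  have "w' \<noteq> []" using Cons.prems p by auto
  then obtain l u w'' where w': "w' = (l, u) # w''" by (metis list.exhaust prod.exhaust)
  have kl: "1 \<le> k" "1 \<le> l" using Cons.prems p w' by auto
  define V where "V = place b w'"
  let ?s = "start b t" and ?r = "start b u"
  have V1: "V = {?s..<?s + k} \<union> place (?s + k + 1) w" using Cons.prems by (simp add: V_def p)
  have V2: "V = {?r..<?r + l} \<union> place (?r + l + 1) w''" by (simp add: V_def w')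
  have ge1: "x \<in> {?s..<?s + k} \<or> ?s + k < x" if "x \<in> V" for x
    using that place_ge[of "?s + k + 1" w] unfolding V1 by auto
  have ge2: "x \<in> {?r..<?r + l} \<or> ?r + l < x" if "x \<in> V" for x
    using that place_ge[of "?r + l + 1" w''] unfolding V2 by auto
  have "?s \<in> V" using kl by (auto simp: V1)
  moreover have "?r \<in> V" using kl by (auto simp: V2)
  ultimately have sr: "?s = ?r" using ge1[of ?r] ge2[of ?s] by auto
  then have t: "t = u" using start_props(1) by metis
  have "\<not> k < l" using ge1[of "?s + k"] sr unfolding V2 by auto
  moreover have "\<not> l < k" using ge2[of "?r + l"] sr unfolding V1 by auto
  ultimately have k: "k = l" by simp
  have "place (?s + k + 1) w = V \<inter> {?s + k<..}"
    using place_ge[of "?s + k + 1" w] unfolding V1 by auto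
  moreover have "place (?r + l + 1) w'' = V \<inter> {?r + l<..}"
    using place_ge[of "?r + l + 1" w''] unfolding V2 by auto
  ultimately have "w = w''" using Cons.IH[of w'' "?s + k + 1"] Cons.prems p w' sr k by simp
  then show ?case using t k by (simp add: p w')
qed

section \<open>A count of small components that reflection preserves\<close>

definition small :: "word \<Rightarrow> nat" where
  "small w = length (filter (\<lambda>(k, t). k \<le> 2) w)"

definition windows :: "nat \<Rightarrow> nat set \<Rightarrow> nat set" where
  "windows d V = {x. {x..x + d} \<subseteq> V}"

lemma windows_subset: "windows d V \<subseteq> V"
  by (auto simp: windows_def)

lemma finite_windows: "finite V \<Longrightarrow> finite (windows d V)"
  using windows_subset finite_subset by blast

text \<open>A window consists of \<open>d + 1\<close> consecutive vertices and never crosses a gap;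
  truncated subtraction accounts for runs that are too short.\<close>

lemma card_windows_place: "card (windows d (place b w)) = (\<Sum>(k, t)\<leftarrow>w. k - d)"
proof (induction b w rule: place.induct)
  case (1 b)
  then show ?case by (auto simp: windows_def)
next
  case (2 b k t w)
  let ?s = "start b t" and ?R = "place (start b t + k + 1) w"
  have R: "?s + k < x" if "x \<in> ?R" for x using that place_ge[of "?s + k + 1" w] by auto
  have "windows d (place b ((k, t) # w)) = {?s..<?s + (k - d)} \<union> windows d ?R"
  proof (intro equalityI subsetI)
    fix x assume "x \<in> windows d (place b ((k, t) # w))"
    then have x: "z \<in> {?s..<?s + k} \<or> z \<in> ?R" if "x \<le> z" "z \<le> x + d" for z
      using that by (auto simp: windows_def)
    have no: "\<not> (x \<le> ?s + k \<and> ?s + k \<le> x + d)" using x[of "?s + k"] R[of "?s + k"] by auto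
    show "x \<in> {?s..<?s + (k - d)} \<union> windows d ?R"
    proof (cases "x < ?s + k")
      case True
      then have "?s \<le> x" using x[of x] R[of x] by auto
      then show ?thesis using True no by auto
    next
      case False
      then have "x \<in> windows d ?R" using x by (auto simp: windows_def)
      then show ?thesis ..
    qed
  next
    fix x assume "x \<in> {?s..<?s + (k - d)} \<union> windows d ?R"
    then show "x \<in> windows d (place b ((k, t) # w))"
      by (auto simp: windows_def subset_iff)
  qed
  moreover have "{?s..<?s + (k - d)} \<inter> windows d ?R = {}"
    using windows_subset[of d ?R] R by fastforce
  ultimately show ?case using 2 by (simp add: card_Un_disjoint finite_windows)
qed

text \<open>
  For \<open>k \<ge> 1\<close>, the truncated differences satisfy \<open>k - (k - 1) - (k - 2) + (k - 3) = 1\<close> if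
  \<open>k \<le> 2\<close>, and \<open>= 0\<close> otherwise. The number of small components is thus determined by
  quantities that a reflection visibly preserves.
\<close>

lemma small_eq_windows:
  assumes "valid w"
  shows "small w + card (windows 1 (place b w)) + card (windows 2 (place b w)) =
    card (windows 0 (place b w)) + card (windows 3 (place b w))"
  using assms unfolding card_windows_place
proof (induction w)
  case (Cons p w)
  obtain k t where p: "p = (k, t)" by force
  have "(if k \<le> 2 then 1 else 0) + (k - 1) + (k - 2) = k + (k - 3)"
    using Cons.prems p by auto
  then show ?case using Cons p by (auto simp: small_def split: if_splits)
qed (simp add: small_def)

definition reflect :: "nat \<Rightarrow> nat \<Rightarrow> nat set \<Rightarrow> nat set" where
  "reflect a b V = {x. if a \<le> x \<and> x \<le> b then a + b - x \<in> V else x \<in> V}"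

lemma reflect_reflect: "reflect a b (reflect a b V) = V"
  by (auto simp: reflect_def)

lemma finite_reflect: "finite V \<Longrightarrow> finite (reflect a b V)"
  by (rule finite_subset[of _ "{a..b} \<union> V"]) (auto simp: reflect_def)

lemma mem_reflect_outside: "x < a \<or> b < x \<Longrightarrow> x \<in> reflect a b V \<longleftrightarrow> x \<in> V"
  by (auto simp: reflect_def)

text \<open>The margins of three vertices are filled on both sides, so reflecting
  \<open>{a..b}\<close> mirrors the whole interval from \<open>a - 3\<close> to
  \<open>b + 3\<close>.\<close>

lemma mem_reflect_mirror:
  assumes "3 \<le> a" "a \<le> b" "{a - 3..<a} \<subseteq> V" "{b<..b + 3} \<subseteq> V" "a - 3 \<le> x" "x \<le> b + 3"
  shows "a + b - x \<in> reflect a b V \<longleftrightarrow> x \<in> V"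
proof -
  consider "x < a" | "b < x" | "a \<le> x" "x \<le> b" by linarith
  then show ?thesis
  proof cases
    case 1
    then have "x \<in> {a - 3..<a}" "a + b - x \<in> {b<..b + 3}" using assms(1,2,5) by auto
    then have "x \<in> V" "a + b - x \<in> V" using assms(3,4) by blast+
    then show ?thesis using 1 assms by (subst mem_reflect_outside) auto
  next
    case 2
    then have "x \<in> {b<..b + 3}" "a + b - x \<in> {a - 3..<a}" using assms(1,2,6) by auto
    then have "x \<in> V" "a + b - x \<in> V" using assms(3,4) by blast+
    then show ?thesis using 2 assms by (subst mem_reflect_outside) auto
  next
    case 3
    then show ?thesis by (auto simp: reflect_def)
  qed
qed

text \<open>A window of at most four vertices either lies within the mirrored interval including its
  margins, or misses \<open>{a..b}\<close> altogether. This is why margins of three are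
  wanted.\<close>

lemma card_windows_reflect:
  assumes "3 \<le> a" "a \<le> b" "{a - 3..<a} \<subseteq> V" "{b<..b + 3} \<subseteq> V" "d \<le> 3"
  shows "card (windows d (reflect a b V)) = card (windows d V)"
proof -
  \<comment> \<open>The mirror image of the window from \<open>x\<close> to \<open>x + d\<close>
    starts at the image of its last vertex.\<close>
  let ?f = "\<lambda>x. if a - 3 \<le> x \<and> x + d \<le> b + 3 then a + b - d - x else x"
  have mirror: "\<exists>y. a + b = x + d + y \<and> a - 3 \<le> y \<and> y + d \<le> b + 3"
    if "a - 3 \<le> x" "x + d \<le> b + 3" for x
  proof -
    have "x + d \<le> a + b" using that assms(1) by linarith
    then obtain y where y: "a + b = x + d + y" using le_Suc_ex by blast
    then have "a - 3 \<le> y" "y + d \<le> b + 3" using that assms(1,2,5) by linarith+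
    then show ?thesis using y by blast
  qed
  have inv: "?f (?f x) = x" for x
  proof (cases "a - 3 \<le> x \<and> x + d \<le> b + 3")
    case True
    then obtain y where "a + b = x + d + y" "a - 3 \<le> y" "y + d \<le> b + 3" using mirror by blast
    then show ?thesis using True by simp
  next
    case False
    then show ?thesis by (simp only: if_False)
  qed
  have imp: "?f x \<in> windows d (reflect a b W)"
    if "x \<in> windows d W" and W: "{a - 3..<a} \<subseteq> W" "{b<..b + 3} \<subseteq> W" for x W
  proof (cases "a - 3 \<le> x \<and> x + d \<le> b + 3")
    case True
    then obtain y where y: "a + b = x + d + y" "a - 3 \<le> y" "y + d \<le> b + 3" using mirror by blast
    have "z \<in> reflect a b W" if z: "y \<le> z" "z \<le> y + d" for z
    proof -
      have "z \<le> a + b" using y z by linarith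
      then obtain u where u: "a + b = u + z" using le_Suc_ex add.commute by metis
      then have u': "x \<le> u" "u \<le> x + d" using y z by linarith+
      then have "u \<in> W" using \<open>x \<in> windows d W\<close> by (simp add: windows_def subset_iff)
      moreover have "a - 3 \<le> u" "u \<le> b + 3" using u' True by linarith+
      ultimately show ?thesis using mem_reflect_mirror[OF assms(1,2) W, of u] u by simp
    qed
    then have "y \<in> windows d (reflect a b W)" by (auto simp: windows_def)
    then show ?thesis using True y by simp
  next
    case False
    have "z \<in> reflect a b W" if "x \<le> z" "z \<le> x + d" for z
    proof -
      have "z \<in> W" using that \<open>x \<in> windows d W\<close> by (auto simp: windows_def)
      moreover have "z < a \<or> b < z" using that False assms(1,2,5) by linarith
      ultimately show ?thesis by (simp add: mem_reflect_outside)
    qed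
    then have "x \<in> windows d (reflect a b W)" by (auto simp: windows_def)
    then show ?thesis using False by (simp only: if_False)
  qed
  have R: "{a - 3..<a} \<subseteq> reflect a b V" "{b<..b + 3} \<subseteq> reflect a b V"
    using assms(3,4) by (auto simp: reflect_def)
  have "bij_betw ?f (windows d V) (windows d (reflect a b V))"
  proof (rule bij_betw_byWitness[of _ ?f])
    show "?f ` windows d V \<subseteq> windows d (reflect a b V)"
      by (rule image_subsetI) (rule imp[OF _ assms(3,4)])
    show "?f ` windows d (reflect a b V) \<subseteq> windows d V"
      by (rule image_subsetI) (rule imp[OF _ R, unfolded reflect_reflect])
  qed (intro ballI inv)+
  then show ?thesis by (rule bij_betw_same_card[symmetric])
qed

text \<open>Three consecutive vertices that cross an end of \<open>{a..b}\<close> contain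
  \<open>a - 1\<close> or \<open>Suc b\<close>; all others are mirrored or left alone.\<close>

lemma spaced_reflect:
  assumes "spaced 1 V" "1 \<le> a" "a - 1 \<in> V" "Suc b \<in> V" "a \<le> b"
  shows "spaced 1 (reflect a b V)"
proof -
  have V: "\<exists>z\<in>V. x \<le> z \<and> z \<le> x + 2" if "y \<in> V" "x \<le> y" for x y
    by (rule spacedD[OF assms(1) that(1) _ that(2)]) simp
  have "\<exists>z\<in>reflect a b V. x \<le> z \<and> z \<le> x + 2" if y: "y \<in> reflect a b V" "x \<le> y" for x y
  proof -
    consider "b < x" | "x < a" "a \<le> x + 3" | "x + 3 < a" | "a \<le> x" "x \<le> b" "b < x + 2"
      | "a \<le> x" "x + 2 \<le> b" by linarith
    then show ?thesis
    proof cases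
      case 1
      then have "y \<in> V" using y by (auto simp: reflect_def)
      then obtain z where "z \<in> V" "x \<le> z" "z \<le> x + 2" using V y by blast
      then show ?thesis using 1 by (intro bexI[of _ z]) (auto simp: reflect_def)
    next
      case 2
      then show ?thesis using assms by (intro bexI[of _ "a - 1"]) (auto simp: reflect_def)
    next
      case 3
      then obtain z where "z \<in> V" "x \<le> z" "z \<le> x + 2" using V[OF assms(3), of x] by force
      then show ?thesis using 3 by (intro bexI[of _ z]) (auto simp: reflect_def)
    next
      case 4
      then show ?thesis using assms by (intro bexI[of _ "Suc b"]) (auto simp: reflect_def)
    next
      case 5
      then obtain z where "z \<in> V" "a + b - (x + 2) \<le> z" "z \<le> a + b - (x + 2) + 2"
        using V[OF assms(4), of "a + b - (x + 2)"] by force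
      then show ?thesis using 5 by (intro bexI[of _ "a + b - z"]) (auto simp: reflect_def)
    qed
  qed
  moreover have "reflect a b V \<subseteq> {1..}" using spaced_subset[OF assms(1)] assms(2) by (auto simp: reflect_def split: if_splits)
  moreover have "finite (reflect a b V)" using spaced_subset[OF assms(1)] finite_reflect by blast
  ultimately show ?thesis by (intro spacedI) blast+
qed

section \<open>Leftmost and rightmost occurrences\<close>

lemma has_appendI:
  "valid u \<Longrightarrow> has (V \<inter> {..<e}) u \<Longrightarrow> has (V \<inter> {e<..}) v \<Longrightarrow> has V (u @ v)"
proof (induction u arbitrary: V)
  case Nil
  then show ?case using has_mono by auto
next
  case (Cons p u)
  obtain k t where p: "p = (k, t)" by force
  obtain y where y: "{y..<y + k} \<subseteq> V \<inter> {..<e}" "3 \<le> k \<longrightarrow> odd y = t"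
    "has (V \<inter> {..<e} \<inter> {y + k<..}) u"
    using Cons.prems(2) unfolding p by auto
  have "y + (k - 1) \<in> {y..<y + k}" using Cons.prems(1) p by auto
  then have "y + (k - 1) < e" using y(1) by blast
  then have "y + k \<le> e" using Cons.prems(1) p by auto
  then have "V \<inter> {y + k<..} \<inter> {e<..} = V \<inter> {e<..}" by auto
  moreover have "has (V \<inter> {y + k<..} \<inter> {..<e}) u" using y(3) by (simp add: Int_ac)
  ultimately have "has (V \<inter> {y + k<..}) (u @ v)"
    using Cons.IH[of "V \<inter> {y + k<..}"] Cons.prems p by simp
  then show ?case using y by (auto simp: p)
qed

text \<open>The cut vertex \<open>e\<close> belongs to neither side: it is the vertex left out
  between the last component of \<open>u\<close> and the first of \<open>v\<close>.\<close>

lemma has_appendE: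
  "0 \<notin> V \<Longrightarrow> has V (u @ v) \<Longrightarrow> \<exists>e. has (V \<inter> {..<e}) u \<and> has (V \<inter> {e<..}) v"
proof (induction u arbitrary: V)
  case Nil
  \<comment> \<open>For empty \<open>u\<close> the cut is at 0, which loses nothing since 0 is not
    in \<open>V\<close>.\<close>
  moreover have "V \<inter> {0<..} = V" using Nil.prems(1) by (auto intro: gr0I)
  ultimately show ?case by (intro exI[of _ 0]) simp
next
  case (Cons p u)
  obtain k t where p: "p = (k, t)" by force
  obtain y where y: "{y..<y + k} \<subseteq> V" "3 \<le> k \<longrightarrow> odd y = t" "has (V \<inter> {y + k<..}) (u @ v)"
    using Cons.prems(2) unfolding p by auto
  obtain e where e: "has (V \<inter> {y + k<..} \<inter> {..<e}) u" "has (V \<inter> {y + k<..} \<inter> {e<..}) v"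
    using Cons.IH[OF _ y(3)] Cons.prems(1) by auto
  let ?e = "max e (y + k)"
  have "has (V \<inter> {..<?e} \<inter> {y + k<..}) u" using e(1) by (rule has_mono) auto
  moreover have "has (V \<inter> {?e<..}) v" using e(2) by (rule has_mono) auto
  moreover have "{y..<y + k} \<subseteq> V \<inter> {..<?e}" using y(1) by auto
  ultimately show ?case using y(2) unfolding p has.simps by blast
qed

lemma has_nonempty: "valid w \<Longrightarrow> w \<noteq> [] \<Longrightarrow> has V w \<Longrightarrow> V \<noteq> {}"
  by (cases w) auto

text \<open>
  The leftmost occurrence of \<open>U\<close> in \<open>V\<close> ends just before \<open>a\<close>, and the rightmost occurrence of \<open>W\<close>
  begins just after \<open>b\<close>. The vertices \<open>a\<close> and \<open>b\<close> are adjacent to these occurrences, so that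
  whatever lies between \<open>U\<close> and \<open>W\<close> has to be embedded strictly between \<open>a\<close> and \<open>b\<close>.
\<close>

definition cut_pair :: "word \<Rightarrow> word \<Rightarrow> nat set \<Rightarrow> nat \<Rightarrow> nat \<Rightarrow> bool" where
  "cut_pair U W V a b \<longleftrightarrow> a \<le> b \<and> has (V \<inter> {..<a}) U \<and> (\<forall>e<a. \<not> has (V \<inter> {..<e}) U) \<and>
     has (V \<inter> {b<..}) W \<and> (\<forall>e>b. \<not> has (V \<inter> {e<..}) W)"

lemma cut_unique: "cut_pair U W V a b \<Longrightarrow> cut_pair U W V a' b' \<Longrightarrow> a = a' \<and> b = b'"
  unfolding cut_pair_def by (metis linorder_neqE_nat)

text \<open>An exchange argument: moving \<open>U\<close> to its leftmost and \<open>W\<close> to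
  its rightmost occurrence only widens the room for \<open>X\<close>.\<close>

lemma has_append3_iff_cut:
  assumes "0 \<notin> V" "finite V" "valid U" "valid X" "valid W" "X \<noteq> []" "W \<noteq> []"
  shows "has V (U @ X @ W) \<longleftrightarrow> (\<exists>a b. cut_pair U W V a b \<and> has (V \<inter> {a<..<b}) X)"
proof
  assume "has V (U @ X @ W)"
  then obtain e where e: "has (V \<inter> {..<e}) U" "has (V \<inter> {e<..}) (X @ W)"
    using has_appendE[OF assms(1)] by blast
  then obtain e' where e': "has (V \<inter> {e<..} \<inter> {..<e'}) X" "has (V \<inter> {e<..} \<inter> {e'<..}) W"
    using has_appendE[of "V \<inter> {e<..}" X W] assms(1) by auto
  \<comment> \<open>A nonempty \<open>X\<close> keeps the two cuts apart, which yields
    \<open>a \<le> b\<close>.\<close>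
  have "V \<inter> {e<..} \<inter> {..<e'} \<noteq> {}" using has_nonempty[OF assms(4,6) e'(1)] .
  then have "e < e'" by auto
  define a where "a = (LEAST a. has (V \<inter> {..<a}) U)"
  have a: "has (V \<inter> {..<a}) U" "\<forall>x<a. \<not> has (V \<inter> {..<x}) U" "a \<le> e"
    unfolding a_def using LeastI[of "\<lambda>a. has (V \<inter> {..<a}) U", OF e(1)] not_less_Least
      Least_le[of "\<lambda>a. has (V \<inter> {..<a}) U", OF e(1)] by blast+
  have W: "has (V \<inter> {e'<..}) W" using e'(2) by (rule has_mono) auto
  \<comment> \<open>A nonempty \<open>W\<close> bounds the cuts on the right, so that a greatest one
    exists.\<close>
  have bound: "y \<le> Max V" if y: "has (V \<inter> {y<..}) W" for y
  proof -
    obtain z where "z \<in> V \<inter> {y<..}" using has_nonempty[OF assms(5,7) y] by blast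
    then show ?thesis using Max_ge[OF assms(2), of z] by auto
  qed
  define b where "b = (GREATEST b. has (V \<inter> {b<..}) W)"
  have le_b: "x \<le> b" if "has (V \<inter> {x<..}) W" for x
    unfolding b_def by (rule Greatest_le_nat[where P = "\<lambda>b. has (V \<inter> {b<..}) W", OF that bound])
  have b: "has (V \<inter> {b<..}) W"
    unfolding b_def by (rule GreatestI_nat[where P = "\<lambda>b. has (V \<inter> {b<..}) W", OF W bound])
  have b': "\<forall>x>b. \<not> has (V \<inter> {x<..}) W" "e' \<le> b" using le_b W by (auto dest: leD)
  have "has (V \<inter> {a<..<b}) X" using e'(1) by (rule has_mono) (use a(3) b'(2) in auto)
  then show "\<exists>a b. cut_pair U W V a b \<and> has (V \<inter> {a<..<b}) X"
    using a b b' \<open>e < e'\<close> unfolding cut_pair_def by (intro exI[of _ a] exI[of _ b]) auto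
next
  assume "\<exists>a b. cut_pair U W V a b \<and> has (V \<inter> {a<..<b}) X"
  then obtain a b where ab: "a \<le> b" "has (V \<inter> {..<a}) U" "has (V \<inter> {b<..}) W" "has (V \<inter> {a<..<b}) X"
    unfolding cut_pair_def by blast
  have "has (V \<inter> {a<..} \<inter> {..<b}) X" using ab(4) by (rule has_mono) auto
  moreover have "has (V \<inter> {a<..} \<inter> {b<..}) W" using ab(3) by (rule has_mono) (use ab(1) in auto)
  ultimately have "has (V \<inter> {a<..}) (X @ W)" by (rule has_appendI[OF assms(4)])
  then show "has V (U @ X @ W)" by (rule has_appendI[OF assms(3) ab(2)])
qed

text \<open>By minimality of \<open>a\<close> the last component ends at \<open>a - 1\<close>;
  otherwise the cut could move left.\<close>

lemma cut_left_run:
  assumes "cut_pair (A @ [(k, t)]) W V a b" "0 \<notin> V" "valid A" "1 \<le> k"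
  shows "k < a" "{a - k..<a} \<subseteq> V"
proof -
  have has: "has (V \<inter> {..<a}) (A @ [(k, t)])" and min: "\<forall>e<a. \<not> has (V \<inter> {..<e}) (A @ [(k, t)])"
    using assms(1) by (auto simp: cut_pair_def)
  obtain e where e: "has (V \<inter> {..<a} \<inter> {..<e}) A" "has (V \<inter> {..<a} \<inter> {e<..}) [(k, t)]"
    using has_appendE[OF _ has] assms(2) by auto
  obtain y where y: "{y..<y + k} \<subseteq> V \<inter> {..<a} \<inter> {e<..}" "3 \<le> k \<longrightarrow> odd y = t"
    using e(2) by auto
  have "y \<in> {y..<y + k}" using assms(4) by auto
  then have y1: "y \<in> V" "e < y" using y(1) by blast+
  have "has (V \<inter> {..<y + k} \<inter> {..<e}) A" using e(1) by (rule has_mono) (use y1 in auto)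
  moreover have "has (V \<inter> {..<y + k} \<inter> {e<..}) [(k, t)]"
    using y by (auto intro!: exI[of _ y])
  ultimately have "has (V \<inter> {..<y + k}) (A @ [(k, t)])" using assms(3) by (intro has_appendI)
  then have "a \<le> y + k" using min not_le by blast
  moreover have "y + (k - 1) \<in> {y..<y + k}" using assms(4) by auto
  then have "y + (k - 1) < a" using y(1) by blast
  then have "y + k \<le> a" using assms(4) by auto
  ultimately have "a = y + k" by simp
  moreover have "y \<noteq> 0" using y1 assms(2) by metis
  ultimately show "k < a" "{a - k..<a} \<subseteq> V" using y(1) by auto
qed

lemma cut_right_run:
  assumes "cut_pair U ((k, t) # B) V a b" "1 \<le> k"
  shows "{b<..b + k} \<subseteq> V"
proof -
  have has: "has (V \<inter> {b<..}) ((k, t) # B)" and max: "\<forall>e>b. \<not> has (V \<inter> {e<..}) ((k, t) # B)"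
    using assms(1) by (auto simp: cut_pair_def)
  obtain y where y: "{y..<y + k} \<subseteq> V \<inter> {b<..}" "3 \<le> k \<longrightarrow> odd y = t"
    "has (V \<inter> {b<..} \<inter> {y + k<..}) B" using has by auto
  have "y \<in> {y..<y + k}" using assms(2) by auto
  then have yb: "b < y" using y(1) by blast
  have "has (V \<inter> {y - 1<..} \<inter> {y + k<..}) B" using y(3) by (rule has_mono) auto
  moreover have "{y..<y + k} \<subseteq> V \<inter> {y - 1<..}" using y(1) yb by auto
  ultimately have "has (V \<inter> {y - 1<..}) ((k, t) # B)" using y(2) unfolding has.simps by blast
  then have "\<not> b < y - 1" using max by blast
  then have "y = Suc b" using yb by simp
  then show ?thesis using y(1) by auto
qed

text \<open>The defining conditions inspect \<open>V\<close> only outside \<open>{a..b}\<close>.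
  Hence the reflection finds the same cut again and is an involution.\<close>

lemma cut_reflect: "cut_pair U W V a b \<Longrightarrow> cut_pair U W (reflect a b V) a b"
proof -
  assume c: "cut_pair U W V a b"
  have "reflect a b V \<inter> {..<e} = V \<inter> {..<e}" if "e \<le> a" for e
    using that by (auto simp: reflect_def)
  moreover have "reflect a b V \<inter> {e<..} = V \<inter> {e<..}" if "b \<le> e" for e
    using that by (auto simp: reflect_def)
  ultimately show ?thesis using c unfolding cut_pair_def by (metis less_imp_le order_refl)
qed

text \<open>A set without a cut contains neither of the two patterns, so it may stay fixed.\<close>

definition flip :: "word \<Rightarrow> word \<Rightarrow> nat set \<Rightarrow> nat set" where
  "flip U W V = (if \<exists>a b. cut_pair U W V a b
     then reflect (THE a. \<exists>b. cut_pair U W V a b) (THE b. \<exists>a. cut_pair U W V a b) V else V)"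

lemma flip_cut: "cut_pair U W V a b \<Longrightarrow> flip U W V = reflect a b V"
proof -
  assume c: "cut_pair U W V a b"
  then have "(THE a. \<exists>b. cut_pair U W V a b) = a" "(THE b. \<exists>a. cut_pair U W V a b) = b"
    using cut_unique by blast+
  then show ?thesis using c by (auto simp: flip_def)
qed

lemma flip_no_cut: "\<nexists>a b. cut_pair U W V a b \<Longrightarrow> flip U W V = V"
  unfolding flip_def by (rule if_not_P)

lemma flip_flip: "flip U W (flip U W V) = V"
proof (cases "\<exists>a b. cut_pair U W V a b")
  case True
  then obtain a b where "cut_pair U W V a b" by blast
  then show ?thesis using cut_reflect flip_cut reflect_reflect by metis
qed (simp add: flip_no_cut)

text \<open>The letters of size 3 at the inner ends of \<open>U\<close> and \<open>W\<close> supply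
  the filled margins: \<open>spaced_reflect\<close> uses one vertex on each side,
  \<open>card_windows_reflect\<close> three.\<close>

lemma
  assumes "spaced 1 V" "valid A" "W = (3, t) # B" "U = A @ [(3, s)]"
  shows spaced_flip: "spaced 1 (flip U W V)"
    and card_windows_flip: "d \<le> 3 \<Longrightarrow> card (windows d (flip U W V)) = card (windows d V)"
proof -
  have "spaced 1 (flip U W V) \<and> (d \<le> 3 \<longrightarrow> card (windows d (flip U W V)) = card (windows d V))"
  proof (cases "\<exists>a b. cut_pair U W V a b")
    case True
    then obtain a b where c: "cut_pair U W V a b" by blast
    have "0 \<notin> V" using assms(1) by (auto simp: spaced_def)
    then have l: "3 < a" "{a - 3..<a} \<subseteq> V" using cut_left_run[of A 3 s W V a b] c assms by auto
    have r: "{b<..b + 3} \<subseteq> V" using cut_right_run[of U 3 t B V a b] c assms by auto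
    have "a \<le> b" using c by (simp add: cut_pair_def)
    then show ?thesis unfolding flip_cut[OF c]
      using l r by (intro conjI impI spaced_reflect card_windows_reflect assms(1)) (auto simp: subset_iff)
  next
    case False
    then show ?thesis using assms(1) by (simp only: flip_no_cut simp_thms)
  qed
  then show "spaced 1 (flip U W V)"
    "d \<le> 3 \<Longrightarrow> card (windows d (flip U W V)) = card (windows d V)" by auto
qed

lemma has_12: "has M [(1, False), (2, False)] \<longleftrightarrow> (\<exists>x\<in>M. \<exists>y\<in>M. Suc y \<in> M \<and> Suc x < y)"
proof -
  have *: "{y..<y + 1} = {y}" "{y..<y + 2} = {y, Suc y}" for y :: nat by auto
  show ?thesis unfolding has.simps * by (auto simp: Bex_def dest: Suc_lessD; blast dest: Suc_lessD)
qed

lemma has_21: "has M [(2, False), (1, False)] \<longleftrightarrow> (\<exists>x\<in>M. \<exists>y\<in>M. Suc y \<in> M \<and> Suc (Suc y) < x)"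
proof -
  have *: "{y..<y + 1} = {y}" "{y..<y + 2} = {y, Suc y}" for y :: nat by auto
  show ?thesis unfolding has.simps * by (auto simp: Bex_def dest: Suc_lessD; blast dest: Suc_lessD)
qed

text \<open>The mirror reverses the order of the path and sends the pair \<open>y\<close>,
  \<open>Suc y\<close> to a pair starting at \<open>a + b - Suc y\<close>. Its parity may change,
  but neither component carries a parity condition.\<close>

lemma has_21_reflect:
  "has (reflect a b V \<inter> {a<..<b}) [(2, False), (1, False)] \<longleftrightarrow>
   has (V \<inter> {a<..<b}) [(1, False), (2, False)]"
proof
  assume "has (reflect a b V \<inter> {a<..<b}) [(2, False), (1, False)]"
  then obtain x y where "a < y" "Suc (Suc y) < x" "x < b" "a + b - x \<in> V" "a + b - y \<in> V" "a + b - Suc y \<in> V"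
    unfolding has_21 by (auto simp: reflect_def split: if_splits)
  then show "has (V \<inter> {a<..<b}) [(1, False), (2, False)]" unfolding has_12
    by (intro bexI[of _ "a + b - x"] bexI[of _ "a + b - Suc y"]) (auto simp: Suc_diff_Suc)
next
  assume "has (V \<inter> {a<..<b}) [(1, False), (2, False)]"
  then obtain x y where "a < x" "Suc x < y" "Suc y < b" "x \<in> V" "y \<in> V" "Suc y \<in> V"
    unfolding has_12 by auto
  then show "has (reflect a b V \<inter> {a<..<b}) [(2, False), (1, False)]" unfolding has_21
    by (intro bexI[of _ "a + b - x"] bexI[of _ "a + b - Suc y"]) (auto simp: reflect_def Suc_diff_Suc)
qed

lemma has_flip:
  assumes "spaced 1 V" "valid A" "valid B" "W = (3, t) # B" "U = A @ [(3, s)]"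
  shows "has (flip U W V) (U @ [(2, False), (1, False)] @ W) \<longleftrightarrow> has V (U @ [(1, False), (2, False)] @ W)"
proof -
  have V: "0 \<notin> V'" "finite V'" if "spaced 1 V'" for V' using that by (auto simp: spaced_def)
  note iff = has_append3_iff_cut[OF V, where U = U and W = W]
  have "has (flip U W V) (U @ [(2, False), (1, False)] @ W) \<longleftrightarrow>
      (\<exists>a b. cut_pair U W (flip U W V) a b \<and> has (flip U W V \<inter> {a<..<b}) [(2, False), (1, False)])"
    by (rule iff) (use assms spaced_flip in auto)
  also have "\<dots> \<longleftrightarrow> (\<exists>a b. cut_pair U W V a b \<and> has (V \<inter> {a<..<b}) [(1, False), (2, False)])"
  proof (cases "\<exists>a b. cut_pair U W V a b")
    case True
    then obtain a b where c: "cut_pair U W V a b" by blast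
    then have c': "cut_pair U W (flip U W V) a b" using flip_cut[OF c] cut_reflect by simp
    have "has (flip U W V \<inter> {a<..<b}) [(2, False), (1, False)] \<longleftrightarrow>
      has (V \<inter> {a<..<b}) [(1, False), (2, False)]"
      unfolding flip_cut[OF c] by (rule has_21_reflect)
    then show ?thesis using c c' cut_unique by metis
  qed (simp add: flip_no_cut)
  also have "\<dots> \<longleftrightarrow> has V (U @ [(1, False), (2, False)] @ W)"
    by (rule iff[symmetric]) (use assms in auto)
  finally show ?thesis .
qed

section \<open>Weighted counts of placements\<close>

definition raw_words :: "nat \<Rightarrow> word set" where
  "raw_words n = {w. valid w \<and> size_of w = n}"

definition canon :: "word \<Rightarrow> word" where
  "canon = map (\<lambda>(k, t). (k, t \<and> 3 \<le> k))"

lemma canon_simps [simp]: "canon [] = []" "canon ((k, t) # w) = (k, t \<and> 3 \<le> k) # canon w"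
  by (simp_all add: canon_def)

lemma canonical_canon: "valid w \<Longrightarrow> canonical (canon w)"
  by (induction w) auto

lemma size_canon: "size_of (canon w) = size_of w"
  by (induction w) auto

lemma has_canon: "has V (canon w) = has V w"
  by (induction w arbitrary: V) auto

lemma has_place_canon:
  assumes "valid u" "valid w"
  shows "has (place 1 (canon w)) u \<longleftrightarrow> has (place 1 w) u"
proof -
  have c: "valid (canon w)" using assms canonical_canon canonical_imp_valid by blast
  have "has (place 1 w) (canon w)" "has (place 1 (canon w)) w"
    using has_canon has_place assms(2) c by metis+
  then show ?thesis using has_trans assms c by blast
qed

lemma size_bounds: "valid w \<Longrightarrow> length w \<le> size_of w \<and> fst ` set w \<subseteq> {..size_of w}"
  by (induction w) (fastforce simp: image_subset_iff)+

lemma finite_raw_words: "finite (raw_words n)"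
proof (rule finite_subset)
  show "raw_words n \<subseteq> {w. set w \<subseteq> {..n} \<times> UNIV \<and> length w \<le> n}"
    using size_bounds by (fastforce simp: raw_words_def)
qed (simp add: finite_lists_length_le)

lemma canonical_words_subset: "canonical_words n \<subseteq> raw_words n"
  by (auto simp: canonical_words_def raw_words_def canonical_imp_valid)

lemma finite_canonical_words: "finite (canonical_words n)"
  using canonical_words_subset finite_raw_words finite_subset by blast

text \<open>
  Each small component of a canonical word can be given two parities, hence weighting raw words
  by \<open>(1/2) ^ small w\<close> turns counts of raw words into counts of canonical words.
\<close>

lemma sum_canon_fibre:
  "canonical c \<Longrightarrow> (\<Sum>w | valid w \<and> canon w = c. (1/2::real) ^ small w) = 1"
proof (induction c)
  case Nil
  have "{w. valid w \<and> canon w = []} = {[]}" by (auto simp: canon_def)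
  then show ?case by (simp add: small_def)
next
  case (Cons p c)
  obtain k t where p: "p = (k, t)" by force
  let ?F = "{w. valid w \<and> canon w = c}" and ?H = "{h. (h \<and> 3 \<le> k) = t}"
  have kt: "1 \<le> k" "t \<longrightarrow> 3 \<le> k" using Cons.prems p by auto
  have eq: "{w. valid w \<and> canon w = p # c} = (\<lambda>(h, w). (k, h) # w) ` (?H \<times> ?F)"
  proof (intro equalityI subsetI)
    fix w assume w: "w \<in> {w. valid w \<and> canon w = p # c}"
    then have "w \<noteq> []" by auto
    then obtain l h w' where w': "w = (l, h) # w'" by (metis list.exhaust prod.exhaust)
    then have "l = k" "h \<in> ?H" "w' \<in> ?F" using w by (auto simp: p)
    then show "w \<in> (\<lambda>(h, w). (k, h) # w) ` (?H \<times> ?F)" unfolding w' by force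
  next
    fix w assume "w \<in> (\<lambda>(h, w). (k, h) # w) ` (?H \<times> ?F)"
    then obtain h w' where "w = (k, h) # w'" "h \<in> ?H" "w' \<in> ?F" by force
    then show "w \<in> {w. valid w \<and> canon w = p # c}" using kt by (simp add: p)
  qed
  have "inj_on (\<lambda>(h, w). (k, h) # w) (?H \<times> ?F)" by (auto simp: inj_on_def)
  then have "(\<Sum>w | valid w \<and> canon w = p # c. (1/2::real) ^ small w) =
      (\<Sum>(h, w)\<in>?H \<times> ?F. (1/2) ^ small ((k, h) # w))"
    unfolding eq by (simp add: sum.reindex comp_def case_prod_unfold)
  also have "\<dots> = (\<Sum>h\<in>?H. \<Sum>w\<in>?F. (1/2) ^ small ((k, h) # w))"
    by (rule sum.cartesian_product[symmetric])
  also have "\<dots> = (\<Sum>h\<in>?H. \<Sum>w\<in>?F. (1/2) ^ (if k \<le> 2 then 1 else 0) * (1/2) ^ small w)"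
    by (intro sum.cong refl) (simp add: small_def)
  also have "\<dots> = (\<Sum>h\<in>?H. (1/2) ^ (if k \<le> 2 then 1 else 0) * (\<Sum>w\<in>?F. (1/2) ^ small w))"
    by (simp only: sum_distrib_left)
  also have "\<dots> = (\<Sum>h\<in>?H. (1/2) ^ (if k \<le> 2 then 1 else 0))"
    using Cons by (simp add: p)
  also have "\<dots> = 1"
  proof (cases "k \<le> 2")
    case True
    then have "?H = {True, False}" using kt by auto
    then show ?thesis using True by simp
  next
    case False
    then have "?H = {t}" by auto
    then show ?thesis using False by simp
  qed
  finally show ?case .
qed

text \<open>Avoidance is constant on the raw words with a given canonical form, and each such fibre
  has total weight 1.\<close>

lemma card_canonical_avoiders:
  assumes "valid u"
  shows "real (card {c \<in> canonical_words n. \<not> has (place 1 c) u}) =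
    (\<Sum>w | w \<in> raw_words n \<and> \<not> has (place 1 w) u. (1/2) ^ small w)"
proof -
  let ?C = "{c \<in> canonical_words n. \<not> has (place 1 c) u}"
  let ?R = "{w \<in> raw_words n. \<not> has (place 1 w) u}"
  have fin: "finite ?C" "finite ?R" using finite_canonical_words finite_raw_words by auto
  have "canon ` ?R \<subseteq> ?C"
    using has_place_canon[OF assms] by (auto simp: raw_words_def canonical_words_def canonical_canon size_canon)
  then have "(\<Sum>c\<in>?C. \<Sum>w\<in>{w \<in> ?R. canon w = c}. (1/2::real) ^ small w) = (\<Sum>w\<in>?R. (1/2) ^ small w)"
    using fin by (intro sum.group)
  moreover have "(\<Sum>w\<in>{w \<in> ?R. canon w = c}. (1/2::real) ^ small w) = 1" if "c \<in> ?C" for c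
  proof -
    have "{w \<in> ?R. canon w = c} = {w. valid w \<and> canon w = c}"
      using that has_place_canon[OF assms] size_canon by (auto simp: raw_words_def canonical_words_def)
    then show ?thesis using sum_canon_fibre that by (simp add: canonical_words_def)
  qed
  ultimately show ?thesis by simp
qed

lemma raw_words_place: "bij_betw (place 1) (raw_words n) {V. spaced 1 V \<and> card V = n}"
proof (rule bij_betw_imageI)
  show "inj_on (place 1) (raw_words n)" using place_inject by (auto simp: inj_on_def raw_words_def)
  show "place 1 ` raw_words n = {V. spaced 1 V \<and> card V = n}"
  proof (intro equalityI subsetI)
    fix V assume "V \<in> {V. spaced 1 V \<and> card V = n}"
    then obtain w where "valid w" "place 1 w = V" "card V = n" using ex_place_eq by blast
    then show "V \<in> place 1 ` raw_words n" using card_place[of 1 w] by (auto simp: raw_words_def)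
  qed (auto simp: raw_words_def card_place spaced_place)
qed

text \<open>\<open>flip\<close> is a weight-preserving involution on spaced sets that takes the
  avoiders of one pattern to those of the other.\<close>

lemma swap_12_avoiders:
  assumes "valid A" "valid B"
  shows "card {c \<in> canonical_words n. \<not> has (place 1 c) (A @ [(3, s), (1, False), (2, False), (3, t)] @ B)} =
    card {c \<in> canonical_words n. \<not> has (place 1 c) (A @ [(3, s), (2, False), (1, False), (3, t)] @ B)}"
proof -
  define U where "U = A @ [(3::nat, s)]"
  define W where "W = (3::nat, t) # B"
  define P where "P = {V. spaced 1 V \<and> card V = n}"
  \<comment> \<open>The number of small components, read off from the set by
    \<open>small_eq_windows\<close>, so that it makes sense without a word.\<close>
  define stat where "stat V = card (windows 0 V) + card (windows 3 V) - card (windows 1 V) - card (windows 2 V)" for V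
  let ?X = "U @ [(1, False), (2, False)] @ W" and ?Y = "U @ [(2, False), (1, False)] @ W"
  have stat: "stat (place 1 w) = small w" if "valid w" for w
    using small_eq_windows[OF that, of 1] by (simp add: stat_def)
  have flip: "spaced 1 (flip U W V)" "stat (flip U W V) = stat V" "card (flip U W V) = card V"
    "has (flip U W V) ?Y = has V ?X" if "spaced 1 V" for V
  proof -
    have "windows 0 V' = V'" for V' by (auto simp: windows_def)
    then show "spaced 1 (flip U W V)" "stat (flip U W V) = stat V" "card (flip U W V) = card V"
      "has (flip U W V) ?Y = has V ?X"
      using spaced_flip[OF that assms(1) W_def U_def] has_flip[OF that assms W_def U_def]
        card_windows_flip[OF that assms(1) W_def U_def, of 0] card_windows_flip[OF that assms(1) W_def U_def, of 1]
        card_windows_flip[OF that assms(1) W_def U_def, of 2] card_windows_flip[OF that assms(1) W_def U_def, of 3]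
      by (auto simp: stat_def)
  qed
  have val: "valid ?X" "valid ?Y" using assms by (auto simp: U_def W_def)
  have rw: "(\<Sum>w | w \<in> raw_words n \<and> \<not> has (place 1 w) Z. (1/2::real) ^ small w) =
      (\<Sum>V | V \<in> P \<and> \<not> has V Z. (1/2) ^ stat V)" for Z
  proof -
    have "bij_betw (place 1) {w. w \<in> raw_words n \<and> \<not> has (place 1 w) Z} {V. V \<in> P \<and> \<not> has V Z}"
    proof (rule bij_betw_imageI)
      show "inj_on (place 1) {w. w \<in> raw_words n \<and> \<not> has (place 1 w) Z}"
        by (rule inj_on_subset[OF bij_betw_imp_inj_on[OF raw_words_place]]) blast
      show "place 1 ` {w. w \<in> raw_words n \<and> \<not> has (place 1 w) Z} = {V. V \<in> P \<and> \<not> has V Z}"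
        unfolding P_def bij_betw_imp_surj_on[OF raw_words_place, symmetric] by blast
    qed
    then have "(\<Sum>w | w \<in> raw_words n \<and> \<not> has (place 1 w) Z. (1/2::real) ^ stat (place 1 w)) =
      (\<Sum>V | V \<in> P \<and> \<not> has V Z. (1/2) ^ stat V)"
      by (rule sum.reindex_bij_betw)
    then show ?thesis using stat by (simp add: raw_words_def)
  qed
  have "real (card {c \<in> canonical_words n. \<not> has (place 1 c) ?X}) = (\<Sum>V | V \<in> P \<and> \<not> has V ?X. (1/2) ^ stat V)"
    using card_canonical_avoiders[OF val(1)] rw by simp
  also have "\<dots> = (\<Sum>V | V \<in> P \<and> \<not> has V ?Y. (1/2) ^ stat V)"
  proof (rule sum.reindex_bij_witness[where i = "flip U W" and j = "flip U W"])
    fix V assume V: "V \<in> {V. V \<in> P \<and> \<not> has V ?Y}"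
    then show "flip U W V \<in> {V. V \<in> P \<and> \<not> has V ?X}"
      using flip[of "flip U W V"] flip[of V] by (simp add: P_def flip_flip)
  qed (use flip in \<open>auto simp: P_def flip_flip\<close>)
  also have "\<dots> = real (card {c \<in> canonical_words n. \<not> has (place 1 c) ?Y})"
    using card_canonical_avoiders[OF val(2)] rw by simp
  finally show ?thesis by (simp add: U_def W_def)
qed

section \<open>Counting\<close>

text \<open>Decreases when the two middle letters of a \<open>factor\<close> are swapped, as the larger one moves left.\<close>

fun index_sum :: "word \<Rightarrow> nat" where
  "index_sum [] = 0"
| "index_sum (p # w) = index_sum w + size_of w"

lemma index_sum_append: "index_sum (u @ v) = index_sum u + index_sum v + length u * size_of v"
  by (induction u) auto

text \<open>\<open>(3, False)\<close> stands for 312: the vertices 2, 3, 4 have values 1, 4, 3 and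
  occur in the oscillation in the order 4, 1, 3.\<close>

definition factor :: word where
  "factor = [(3, False), (1, False), (2, False), (3, False)]"

definition reduced :: "word \<Rightarrow> bool" where
  "reduced w \<longleftrightarrow> (\<forall>u v. w \<noteq> u @ factor @ v)"

lemma card_SIO_avoiders:
  assumes "valid u"
  shows "card {p \<in> of_size SIO m. \<not> perm_contained (perm_of u) p} =
    card {c \<in> canonical_words m. \<not> has (place 1 c) u}"
proof -
  have "bij_betw perm_of {c \<in> canonical_words m. \<not> has (place 1 c) u}
      {p \<in> of_size SIO m. \<not> perm_contained (perm_of u) p}"
  proof (rule bij_betw_imageI)
    show "inj_on perm_of {c \<in> canonical_words m. \<not> has (place 1 c) u}"
      by (rule inj_on_subset[OF bij_betw_imp_inj_on[OF bij_betw_perm_of]]) blast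
    show "perm_of ` {c \<in> canonical_words m. \<not> has (place 1 c) u} =
        {p \<in> of_size SIO m. \<not> perm_contained (perm_of u) p}"
      unfolding bij_betw_imp_surj_on[OF bij_betw_perm_of, symmetric]
      using perm_contained_perm_of[OF assms] by blast
  qed
  then show ?thesis by (rule bij_betw_same_card[symmetric])
qed

lemma wilf_equivalence_iff:
  assumes "canonical u" "canonical v"
  shows "(perm_of u, perm_of v) \<in> wilf_equivalence SIO \<longleftrightarrow>
    (\<forall>m. card {c \<in> canonical_words m. \<not> has (place 1 c) u} =
         card {c \<in> canonical_words m. \<not> has (place 1 c) v})"
proof -
  have "perm_of w \<in> SIO" if "canonical w" for w
    using bij_betw_imp_surj_on[OF bij_betw_perm_of[of "size_of w"]] that
    by (auto simp: of_size_def canonical_words_def)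
  then show ?thesis using assms canonical_imp_valid
    by (simp add: wilf_equivalence_def card_SIO_avoiders)
qed

lemma ex_reduced:
  "canonical w \<Longrightarrow> \<exists>w'. canonical w' \<and> size_of w' = size_of w \<and> reduced w' \<and>
     (perm_of w, perm_of w') \<in> wilf_equivalence SIO"
proof (induction "index_sum w" arbitrary: w rule: less_induct)
  case less
  show ?case
  proof (cases "reduced w")
    case True
    then show ?thesis using less.prems by (intro exI[of _ w]) (simp add: wilf_equivalence_iff)
  next
    case False
    then obtain u v where w: "w = u @ factor @ v" by (auto simp: reduced_def)
    define w1 where "w1 = u @ [(3, False), (2, False), (1, False), (3, False)] @ v"
    have c: "canonical u" "canonical v" "canonical w1" "size_of w1 = size_of w"
      using less.prems by (auto simp: w w1_def factor_def)
    have "index_sum w1 < index_sum w"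
      by (simp add: w w1_def factor_def index_sum_append algebra_simps)
    then obtain w' where w': "canonical w'" "size_of w' = size_of w1" "reduced w'"
      "(perm_of w1, perm_of w') \<in> wilf_equivalence SIO"
      using less.hyps c(3) by blast
    have "(perm_of w, perm_of w1) \<in> wilf_equivalence SIO"
      unfolding wilf_equivalence_iff[OF less.prems c(3)] unfolding w w1_def factor_def
      using swap_12_avoiders[OF canonical_imp_valid[OF c(1)] canonical_imp_valid[OF c(2)]] by blast
    then have "(perm_of w, perm_of w') \<in> wilf_equivalence SIO"
      using w'(4) wilf_equivalence_iff less.prems c(3) w'(1) by simp
    then show ?thesis using w' c(4) by auto
  qed
qed

definition reduced_words :: "nat \<Rightarrow> word set" where
  "reduced_words n = {w \<in> canonical_words n. reduced w}"

lemma num_wilf_classes_le: "num_wilf_classes SIO n \<le> card (reduced_words n)"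
proof -
  let ?S = "of_size SIO n"
  let ?R = "Restr (wilf_equivalence SIO) ?S"
  have fin: "finite (reduced_words n)" using finite_canonical_words by (simp add: reduced_words_def)
  have "?S // ?R \<subseteq> (\<lambda>w. ?R `` {perm_of w}) ` reduced_words n"
  proof
    fix X assume "X \<in> ?S // ?R"
    then obtain p where p: "p \<in> ?S" "X = ?R `` {p}" by (auto elim: quotientE)
    obtain w where w: "w \<in> canonical_words n" "p = perm_of w"
      using p(1) bij_betw_imp_surj_on[OF bij_betw_perm_of, of n] by blast
    obtain w' where w': "w' \<in> reduced_words n" "(p, perm_of w') \<in> wilf_equivalence SIO"
      using ex_reduced[of w] w by (auto simp: canonical_words_def reduced_words_def)
    have "perm_of w' \<in> ?S"
      using w'(1) bij_betw_imp_surj_on[OF bij_betw_perm_of, of n] by (auto simp: reduced_words_def)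
    then have "?R `` {p} = ?R `` {perm_of w'}"
      using p(1) w'(2) by (auto simp: wilf_equivalence_def)
    then show "X \<in> (\<lambda>w. ?R `` {perm_of w}) ` reduced_words n" using p(2) w'(1) by blast
  qed
  then have "card (?S // ?R) \<le> card ((\<lambda>w. ?R `` {perm_of w}) ` reduced_words n)"
    using fin by (intro card_mono) auto
  also have "\<dots> \<le> card (reduced_words n)" using fin by (rule card_image_le)
  finally show ?thesis by (simp add: num_wilf_classes_def)
qed

section \<open>Upper bound for reduced words\<close>

definition letters :: "nat \<Rightarrow> (nat \<times> bool) set" where
  "letters n = {1..n} \<times> {False} \<union> {3..n} \<times> {True}"

lemma finite_letters: "finite (letters n)"
  by (simp add: letters_def)

lemma canonical_set_letters:
  assumes "canonical w" "size_of w \<le> n"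
  shows "set w \<subseteq> letters n"
proof
  fix c assume c: "c \<in> set w"
  obtain k t where kt: "c = (k, t)" by force
  have "k \<in> set (map fst w)" using c kt by force
  then have "k \<le> size_of w" by (rule member_le_sum_list) simp
  moreover have "1 \<le> k" "t \<longrightarrow> 3 \<le> k" using assms(1) c by (auto simp: canonical_def kt)
  ultimately show "c \<in> letters n" using assms(2) by (cases t) (auto simp: kt letters_def)
qed

text \<open>Two geometric series: one letter of each size from 1 on, and a second orientation from
  size 3 on.\<close>

lemma sum_letters_le:
  assumes "0 < y" "y < (1::real)"
  shows "(\<Sum>c\<in>letters n. y ^ fst c) \<le> (y + y ^ 3) / (1 - y)"
proof -
  have geo: "(\<Sum>k=m..n. y ^ k) \<le> y ^ m / (1 - y)" for m
  proof (cases "m \<le> n")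
    case True
    have "(1 - y) * (\<Sum>k=m..n. y ^ k) \<le> y ^ m"
      using sum_gp_multiplied[OF True, of y] assms(1) by simp
    then show ?thesis using assms(2) by (simp add: pos_le_divide_eq mult.commute)
  qed (use assms in simp)
  have "(\<Sum>c\<in>letters n. y ^ fst c) = (\<Sum>c\<in>{1..n} \<times> {False}. y ^ fst c) + (\<Sum>c\<in>{3..n} \<times> {True}. y ^ fst c)"
    unfolding letters_def by (rule sum.union_disjoint) auto
  also have "\<dots> = (\<Sum>k=1..n. y ^ k) + (\<Sum>k=3..n. y ^ k)"
    using sum.cartesian_product[of "\<lambda>k b. y ^ k" "{False}" "{1..n}"]
      sum.cartesian_product[of "\<lambda>k b. y ^ k" "{True}" "{3..n}"]
    by (simp add: case_prod_unfold)
  also have "\<dots> \<le> y ^ 1 / (1 - y) + y ^ 3 / (1 - y)"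
    by (intro add_mono geo)
  finally show ?thesis by (simp add: add_divide_distrib)
qed

lemma sum_words_of_length:
  fixes y :: real
  shows "(\<Sum>w | set w \<subseteq> A \<and> length w = l. y ^ size_of w) = (\<Sum>c\<in>A. y ^ fst c) ^ l"
proof (induction l)
  case 0
  have "{w. set w \<subseteq> A \<and> length w = 0} = {[]}" by auto
  then show ?case by simp
next
  case (Suc l)
  let ?T = "{w. set w \<subseteq> A \<and> length w = l}"
  have "{w. set w \<subseteq> A \<and> length w = Suc l} = (\<lambda>(c, w). c # w) ` (A \<times> ?T)"
    by (auto simp: length_Suc_conv image_iff)
  moreover have "inj_on (\<lambda>(c, w). c # w) (A \<times> ?T)" by (auto simp: inj_on_def)
  ultimately have "(\<Sum>w | set w \<subseteq> A \<and> length w = Suc l. y ^ size_of w) =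
      (\<Sum>(c, w)\<in>A \<times> ?T. y ^ size_of (c # w))"
    by (simp add: sum.reindex comp_def case_prod_unfold)
  also have "\<dots> = (\<Sum>c\<in>A. \<Sum>w\<in>?T. y ^ fst c * y ^ size_of w)"
    by (simp add: sum.cartesian_product power_add)
  also have "\<dots> = (\<Sum>c\<in>A. y ^ fst c) * (\<Sum>w\<in>?T. y ^ size_of w)"
    by (rule sum_product[symmetric])
  finally show ?case using Suc by simp
qed

lemma finite_words_of_length: "finite A \<Longrightarrow> finite {w. set w \<subseteq> A \<and> length w = l}"
  by (rule finite_lists_length_eq)

lemma reduced_appendD: "reduced (u @ v) \<Longrightarrow> reduced u \<and> reduced v"
  unfolding reduced_def by (metis append.assoc)

text \<open>
  A reduced word is cut into blocks of four letters, none of which is \<open>factor\<close>.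
\<close>

lemma sum_reduced_words_of_length:
  fixes y :: real
  assumes y: "0 < y" and A: "finite A" "set factor \<subseteq> A"
    and G: "(\<Sum>c\<in>A. y ^ fst c) \<le> 2" "(\<Sum>c\<in>A. y ^ fst c) ^ 4 - y ^ 9 \<le> 1"
  shows "(\<Sum>w | set w \<subseteq> A \<and> length w = l \<and> reduced w. y ^ size_of w) \<le> 8"
proof (induction l rule: less_induct)
  case (less l)
  let ?G = "\<Sum>c\<in>A. y ^ fst c"
  let ?T = "\<lambda>l. {w. set w \<subseteq> A \<and> length w = l}"
  let ?L = "\<lambda>l. {w. set w \<subseteq> A \<and> length w = l \<and> reduced w}"
  have fin: "finite (?T l)" "finite (?L l)" for l
    using finite_words_of_length[OF A(1)] by (auto intro: rev_finite_subset)
  show ?case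
  proof (cases "l < 4")
    case True
    have "0 \<le> ?G" using y by (intro sum_nonneg) auto
    have "(\<Sum>w\<in>?L l. y ^ size_of w) \<le> (\<Sum>w\<in>?T l. y ^ size_of w)"
      using y by (intro sum_mono2 fin) auto
    also have "\<dots> = ?G ^ l" by (rule sum_words_of_length)
    also have "\<dots> \<le> 2 ^ l" using G(1) \<open>0 \<le> ?G\<close> by (rule power_mono)
    \<comment> \<open>The bound 8 pays for the at most three letters left over after cutting off
      blocks of four.\<close>
    also have "\<dots> \<le> 2 ^ 3" using True by (intro power_increasing) auto
    finally show ?thesis by simp
  next
    case False
    have "?L l \<subseteq> (\<lambda>(u, v). u @ v) ` ((?T 4 - {factor}) \<times> ?L (l - 4))"
    proof
      fix w assume w: "w \<in> ?L l"
      have "w = take 4 w @ drop 4 w" by simp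
      moreover have "take 4 w \<noteq> factor" using w unfolding reduced_def
        by (metis (mono_tags, lifting) append_Nil append_take_drop_id mem_Collect_eq)
      moreover have "drop 4 w \<in> ?L (l - 4)"
        using w reduced_appendD[of "take 4 w" "drop 4 w"] set_drop_subset[of 4 w] by auto
      moreover have "take 4 w \<in> ?T 4" using w False set_take_subset[of 4 w] by auto
      ultimately show "w \<in> (\<lambda>(u, v). u @ v) ` ((?T 4 - {factor}) \<times> ?L (l - 4))"
        by (intro image_eqI[of _ _ "(take 4 w, drop 4 w)"]) simp_all
    qed
    then have "(\<Sum>w\<in>?L l. y ^ size_of w) \<le>
        (\<Sum>w\<in>(\<lambda>(u, v). u @ v) ` ((?T 4 - {factor}) \<times> ?L (l - 4)). y ^ size_of w)"
      using y fin by (intro sum_mono2) auto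
    also have "\<dots> = (\<Sum>(u, v)\<in>(?T 4 - {factor}) \<times> ?L (l - 4). y ^ size_of u * y ^ size_of v)"
    proof -
      have "inj_on (\<lambda>(u, v). u @ v) ((?T 4 - {factor}) \<times> ?L (l - 4))" by (auto simp: inj_on_def)
      then show ?thesis by (simp add: sum.reindex comp_def case_prod_unfold power_add)
    qed
    also have "\<dots> = (\<Sum>u\<in>?T 4 - {factor}. y ^ size_of u) * (\<Sum>v\<in>?L (l - 4). y ^ size_of v)"
      by (simp only: sum.cartesian_product[symmetric] sum_product)
    also have "(\<Sum>u\<in>?T 4 - {factor}. y ^ size_of u) = ?G ^ 4 - y ^ 9"
    proof -
      have "factor \<in> ?T 4" "size_of factor = 9" using A(2) by (auto simp: factor_def)
      then show ?thesis using sum_diff1[OF fin(1), of "\<lambda>w. y ^ size_of w" 4 factor]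
          sum_words_of_length[where A = A and l = 4 and y = y] by simp
    qed
    also have "(?G ^ 4 - y ^ 9) * (\<Sum>v\<in>?L (l - 4). y ^ size_of v) \<le> 1 * (\<Sum>v\<in>?L (l - 4). y ^ size_of v)"
      using G(2) y by (intro mult_right_mono sum_nonneg) auto
    also have "\<dots> \<le> 8" using less.IH[of "l - 4"] False by simp
    finally show ?thesis .
  qed
qed

text \<open>
  The generating function of the components is \<open>F z = (z + z^3) / (1 - z)\<close>, and \<open>F z = 1\<close> has the
  solution \<open>z = 0.453397\<dots>\<close>. The number \<open>y\<close> below is slightly larger than this, but still
  \<open>F y ^ 4 - y ^ 9 < 1\<close>; the number \<open>x\<close> in \<open>card_canonical_words_ge\<close> lies strictly between it and \<open>y\<close>.
\<close>

lemma card_reduced_words_le: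
  assumes "3 \<le> n" and y: "y = 45342 / (100000 :: real)"
  shows "real (card (reduced_words n)) * y ^ n \<le> 8 * real (n + 1)"
proof -
  let ?A = "letters n"
  let ?L = "\<lambda>l. {w. set w \<subseteq> ?A \<and> length w = l \<and> reduced w}"
  have finL: "finite (?L l)" for l
    by (rule finite_subset[OF _ finite_words_of_length[OF finite_letters, of n l]]) auto
  have G: "(\<Sum>c\<in>?A. y ^ fst c) \<le> 10002 / 10000"
    by (rule order_trans[OF sum_letters_le]) (simp_all add: y power3_eq_cube)
  have G4: "(\<Sum>c\<in>?A. y ^ fst c) ^ 4 - y ^ 9 \<le> 1"
  proof -
    \<comment> \<open>\<open>F y\<close> is about 1.000107. Its fourth power exceeds 1 by less than
      0.00045, whereas \<open>y ^ 9\<close> is about 0.00081.\<close>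
    have "(\<Sum>c\<in>?A. y ^ fst c) \<le> 100011 / 100000"
      by (rule order_trans[OF sum_letters_le]) (simp_all add: y power3_eq_cube)
    then have "(\<Sum>c\<in>?A. y ^ fst c) ^ 4 \<le> (100011 / 100000) ^ 4"
      by (rule power_mono) (auto intro!: sum_nonneg simp: y)
    also have "\<dots> \<le> 1 + y ^ 9" by (simp add: y power_divide)
    finally show ?thesis by simp
  qed
  \<comment> \<open>Each letter has size at least 1, so only \<open>n + 1\<close> lengths
    occur.\<close>
  have "reduced_words n \<subseteq> (\<Union>l\<le>n. ?L l)"
  proof
    fix w assume w: "w \<in> reduced_words n"
    then have "canonical w" "size_of w = n" "reduced w" by (auto simp: reduced_words_def canonical_words_def)
    then show "w \<in> (\<Union>l\<le>n. ?L l)"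
      using size_bounds[of w] canonical_imp_valid canonical_set_letters[of w n] by auto
  qed
  then have "(\<Sum>w\<in>reduced_words n. y ^ size_of w) \<le> (\<Sum>w\<in>(\<Union>l\<le>n. ?L l). y ^ size_of w)"
    using finL by (intro sum_mono2) (auto simp: y)
  also have "\<dots> = (\<Sum>l\<le>n. \<Sum>w\<in>?L l. y ^ size_of w)"
    using finL by (intro sum.UNION_disjoint) auto
  also have "\<dots> \<le> (\<Sum>l\<le>n. 8)"
  proof (rule sum_mono)
    fix l
    show "(\<Sum>w\<in>?L l. y ^ size_of w) \<le> 8"
    proof (rule sum_reduced_words_of_length[OF _ finite_letters _ _ G4])
      show "0 < y" by (simp add: y)
      show "set factor \<subseteq> letters n" using assms(1) by (auto simp: factor_def letters_def)
      show "(\<Sum>c\<in>letters n. y ^ fst c) \<le> 2" using G by simp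
    qed
  qed
  finally have "(\<Sum>w\<in>reduced_words n. y ^ size_of w) \<le> 8 * real (n + 1)" by simp
  moreover have "(\<Sum>w\<in>reduced_words n. y ^ size_of w) = real (card (reduced_words n)) * y ^ n"
    by (simp add: reduced_words_def canonical_words_def)
  ultimately show ?thesis by simp
qed

section \<open>Lower bound for all canonical words\<close>

definition big_words :: "nat \<Rightarrow> word set" where
  "big_words n = {w \<in> canonical_words n. w \<noteq> [] \<and> 3 \<le> fst (hd w)}"

lemma finite_big_words: "finite (big_words n)"
  using finite_canonical_words by (simp add: big_words_def)

lemma card_canonical_words_rec:
  "card (canonical_words (Suc n)) + card (canonical_words n) + card (big_words (n + 2))
     \<le> card (canonical_words (n + 2))"
proof -
  let ?A = "Cons (1, False) ` canonical_words (Suc n)" and ?B = "Cons (2, False) ` canonical_words n"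
  have "?A \<union> ?B \<union> big_words (n + 2) \<subseteq> canonical_words (n + 2)"
    by (auto simp: canonical_words_def big_words_def)
  then have "card (?A \<union> ?B \<union> big_words (n + 2)) \<le> card (canonical_words (n + 2))"
    using finite_canonical_words by (intro card_mono)
  moreover have "card (?A \<union> ?B \<union> big_words (n + 2)) = card (?A \<union> ?B) + card (big_words (n + 2))"
    using finite_canonical_words finite_big_words by (intro card_Un_disjoint) (auto simp: big_words_def)
  moreover have "card (?A \<union> ?B) = card ?A + card ?B"
    using finite_canonical_words by (intro card_Un_disjoint) auto
  ultimately show ?thesis by (simp add: card_image)
qed

text \<open>Enlarging a big first component by one gives first components of size at least 4; size 3
  is added in its two orientations. This replaces a sum over all sizes by a recurrence of bounded
  order.\<close>

lemma card_big_words_rec: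
  "card (big_words (n + 2)) + 2 * card (canonical_words n) \<le> card (big_words (n + 3))"
proof -
  let ?f = "\<lambda>w. (Suc (fst (hd w)), snd (hd w)) # tl w"
  let ?A = "?f ` big_words (n + 2)" and ?B = "Cons (3, False) ` canonical_words n"
    and ?C = "Cons (3, True) ` canonical_words n"
  have f: "?f w \<in> big_words (n + 3)" "4 \<le> fst (hd (?f w))" if "w \<in> big_words (n + 2)" for w
    using that by (cases w; auto simp: canonical_words_def big_words_def)+
  have "?A \<union> ?B \<union> ?C \<subseteq> big_words (n + 3)"
    using f(1) by (auto simp: canonical_words_def big_words_def)
  then have "card (?A \<union> ?B \<union> ?C) \<le> card (big_words (n + 3))"
    using finite_big_words by (intro card_mono)
  moreover have "card (?A \<union> ?B \<union> ?C) = card (?A \<union> ?B) + card ?C"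
    using finite_canonical_words finite_big_words f(2) by (intro card_Un_disjoint) fastforce+
  moreover have "card (?A \<union> ?B) = card ?A + card ?B"
    using finite_canonical_words finite_big_words f(2) by (intro card_Un_disjoint) fastforce+
  moreover have "card ?A = card (big_words (n + 2))"
  proof (rule card_image, rule inj_onI)
    fix u v assume "u \<in> big_words (n + 2)" "v \<in> big_words (n + 2)" "?f u = ?f v"
    then show "u = v" by (cases u; cases v) (auto simp: big_words_def prod_eq_iff)
  qed
  ultimately show ?thesis by (simp add: card_image)
qed

text \<open>After scaling by \<open>x ^ n\<close> the recurrences preserve constant lower bounds in
  the ratio \<open>1 : ?d\<close>. For \<open>c\<close> this is \<open>x + x^2 + ?d = 1\<close>; for
  \<open>e\<close> it is \<open>x * ?d + 2 * x^3 \<ge> ?d\<close>, which is equivalent to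
  \<open>F x \<ge> 1\<close>.\<close>

lemma card_canonical_words_ge:
  assumes x: "x = 4534 / (10000 :: real)"
  shows "1 / 5 \<le> real (card (canonical_words n)) * x ^ n"
proof -
  define c where "c n = real (card (canonical_words n)) * x ^ n" for n
  define e where "e n = real (card (big_words n)) * x ^ n" for n
  have c_rec: "x * c (Suc n) + x ^ 2 * c n + e (n + 2) \<le> c (n + 2)" for n
  proof -
    have "real (card (canonical_words (Suc n)) + card (canonical_words n) + card (big_words (n + 2))) * x ^ (n + 2)
      \<le> real (card (canonical_words (n + 2))) * x ^ (n + 2)"
      using card_canonical_words_rec[of n] by (intro mult_right_mono) (auto simp: x simp del: of_nat_add)
    then show ?thesis by (simp add: c_def e_def algebra_simps power2_eq_square)
  qed
  have e_rec: "x * e (n + 2) + 2 * x ^ 3 * c n \<le> e (n + 3)" for n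
  proof -
    have "real (card (big_words (n + 2)) + 2 * card (canonical_words n)) * x ^ (n + 3)
      \<le> real (card (big_words (n + 3))) * x ^ (n + 3)"
      using card_big_words_rec[of n] by (intro mult_right_mono) (auto simp: x simp del: of_nat_add)
    then show ?thesis by (simp add: c_def e_def algebra_simps power2_eq_square power3_eq_cube power_add)
  qed
  let ?d = "1 - x - x ^ 2"
  have start: "1 \<le> c 0" "x \<le> c 1"
  proof -
    have "card {[]::word} \<le> card (canonical_words 0)" "card {[(1::nat, False)]} \<le> card (canonical_words 1)"
      by (rule card_mono[OF finite_canonical_words]; simp add: canonical_words_def)+
    then show "1 \<le> c 0" "x \<le> c 1" by (auto simp: c_def x)
  qed
  have e0: "0 \<le> e n" for n by (simp add: e_def x)
  \<comment> \<open>The value 1/5 is small enough for the initial bounds: \<open>c 0\<close>,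
    \<open>c 1\<close>, \<open>c 2\<close> and \<open>e 3\<close> are at least 1, \<open>x\<close>,
    \<open>2 * x^2\<close> and \<open>2 * x^3\<close>.\<close>
  have "1 / 5 \<le> c n \<and> 1 / 5 \<le> c (n + 1) \<and> 1 / 5 \<le> c (n + 2) \<and> ?d / 5 \<le> e (n + 3)"
  proof (induction n)
    case 0
    have "1 / 5 \<le> c 2" using c_rec[of 0, unfolded add_0] start e0[of 2] by (simp add: x power2_eq_square)
    moreover have "?d / 5 \<le> e 3" using e_rec[of 0, unfolded add_0] start(1) e0[of 2] by (simp add: x power2_eq_square power3_eq_cube)
    ultimately show ?case using start unfolding add_0 by (simp add: x)
  next
    case (Suc n)
    have "1 / 5 \<le> c (n + 3)"
      using c_rec[of "n + 1"] Suc by (simp add: x eval_nat_numeral)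
    moreover have "?d / 5 \<le> e (n + 4)"
      using e_rec[of "n + 1"] Suc by (simp add: x eval_nat_numeral)
    ultimately show ?case using Suc by (simp add: eval_nat_numeral)
  qed
  then show ?thesis by (simp add: c_def)
qed

theorem theorem3p4:
  shows "exponential_wilf_collapse SIO"
proof -
  \<comment> \<open>\<open>r\<close> lies strictly between \<open>x / y\<close> and 1; the slack
    makes \<open>q < 1\<close>, and \<open>q ^ n\<close> absorbs the linear factor
    \<open>n + 1\<close>.\<close>
  define r x y :: real where "r = 99999 / 100000" and "x = 4534 / 10000" and "y = 45342 / 100000"
  define q where "q = x / (y * r)"
  have q: "0 \<le> q" "q < 1" by (simp_all add: q_def r_def x_def y_def)
  have pos: "0 < r" "0 < x" "0 < y" by (simp_all add: r_def x_def y_def)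
  have qr: "q * r = x / y" using pos by (simp add: q_def)
  let ?w = "\<lambda>n. real (num_wilf_classes SIO n)"
  let ?c = "\<lambda>n. real (card (of_size SIO n))"
  have c: "1 / 5 \<le> ?c n * x ^ n" for n
    using card_canonical_words_ge[OF x_def, of n] unfolding bij_betw_same_card[OF bij_betw_perm_of] .
  have cpos: "0 < r ^ n * ?c n" for n
  proof -
    have "0 < ?c n * x ^ n" using c[of n] by linarith
    then have "0 < ?c n" using pos(2) by (simp add: zero_less_mult_iff)
    then show ?thesis using pos(1) by simp
  qed
  \<comment> \<open>The 40 is 8 from the reduced words times 5 from the lower bound;
    \<open>3 \<le> n\<close> makes the letters of \<open>factor\<close> available.\<close>
  have bound: "?w n / (r ^ n * ?c n) \<le> 40 * (real n * q ^ n + q ^ n)" if "3 \<le> n" for n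
  proof -
    have "?w n * y ^ n \<le> real (card (reduced_words n)) * y ^ n"
      using num_wilf_classes_le[of n] pos(3) by (intro mult_right_mono) simp_all
    also have "\<dots> \<le> 8 * real (n + 1)" by (rule card_reduced_words_le[OF that y_def])
    also have "\<dots> = 8 * real (n + 1) * 1" by (rule mult_1_right[symmetric])
    also have "\<dots> \<le> 8 * real (n + 1) * (5 * (?c n * x ^ n))"
    proof (rule mult_left_mono)
      show "1 \<le> 5 * (?c n * x ^ n)" using c[of n] by linarith
    qed simp
    also have "\<dots> = 40 * real (n + 1) * ?c n * x ^ n"
      by (simp add: algebra_simps)
    finally have "?w n * y ^ n \<le> 40 * real (n + 1) * ?c n * x ^ n" .
    then have "?w n \<le> 40 * real (n + 1) * ?c n * x ^ n / y ^ n"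
      using pos(3) by (simp only: pos_le_divide_eq zero_less_power)
    also have "\<dots> = 40 * real (n + 1) * ?c n * (q ^ n * r ^ n)"
      by (simp only: power_mult_distrib[symmetric] qr) (simp add: power_divide)
    also have "\<dots> = 40 * (real n * q ^ n + q ^ n) * (r ^ n * ?c n)"
      by (simp add: algebra_simps)
    finally show ?thesis by (simp only: pos_divide_le_eq[OF cpos])
  qed
  have "(\<lambda>n. 40 * (real n * q ^ n + q ^ n)) \<longlonglongrightarrow> 40 * (0 + 0)"
    using q by (intro tendsto_intros powser_times_n_limit_0 LIMSEQ_power_zero) auto
  then have lim: "(\<lambda>n. 40 * (real n * q ^ n + q ^ n)) \<longlonglongrightarrow> 0" by simp
  have "(\<lambda>n. ?w n / (r ^ n * ?c n)) \<longlonglongrightarrow> 0"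
  proof (rule tendsto_sandwich[OF _ _ tendsto_const lim])
    show "\<forall>\<^sub>F n in sequentially. 0 \<le> ?w n / (r ^ n * ?c n)"
      using cpos by (intro always_eventually allI divide_nonneg_pos) simp
    show "\<forall>\<^sub>F n in sequentially. ?w n / (r ^ n * ?c n) \<le> 40 * (real n * q ^ n + q ^ n)"
      using eventually_ge_at_top[of 3] by (rule eventually_mono) (rule bound)
  qed
  then have "?w \<in> o(\<lambda>n. r ^ n * ?c n)"
  proof (rule smalloI_tendsto)
    have "r ^ n * ?c n \<noteq> 0" for n using cpos[of n] by linarith
    then show "\<forall>\<^sub>F n in sequentially. r ^ n * ?c n \<noteq> 0" by (intro always_eventually allI)
  qed
  then show ?thesis unfolding exponential_wilf_collapse_def
    by (intro exI[of _ r]) (simp add: r_def)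
qed

end
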